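(* Let $\alpha=(\alpha_n)_{n\in\mathbb{N}}$ and $\beta=(\beta_n)_{n\in\mathbb{N}}$ be exponent sequences such that $\beta$ is stable and $\Lambda_\infty(\alpha)$ is nuclear. Let $\theta=(\theta_j)_{j\in\mathbb{Z}}$ be a two-sided scalar sequence. If $\theta\in \Lambda_\infty(\beta)\oplus(\Lambda_\infty(\alpha))'$ and $$\exists m\in\mathbb{N}\ \forall k\in\mathbb{N}\ \exists C>0\ \ \forall n\ge k:\quad e^{k\beta_n}\le C e^{m\alpha_n},$$ then the Toeplitz operator $T_\theta:\Lambda_\infty(\alpha)\to\Lambda_\infty(\beta)$ is compact.
   Context: $\mathbb{N}=\{1,2,3,\dots\}$. An exponent sequence is a non-negative increasing sequence $\alpha=(\alpha_n)_{n\in\mathbb{N}}$ with $\lim_n\alpha_n=\infty$. It is stable if $\sup_n \alpha_{2n}/\alpha_n<\infty$ (i.e. there is $M$ with $\alpha_{2n}\le M\alpha_n$ for all $n$). The power series space of infinite type is $\Lambda_\infty(\alpha)=\{x=(x_n)_{n\in\mathbb{N}}: \|x\|_k:=\sum_n|x_n|e^{k\alpha_n}<\infty\ \forall k\in\mathbb{N}\}$, a Fréchet space with the seminorms $\|\cdot\|_k$. It is nuclear iff for every $k$ there is $l>k$ with $\sum_n e^{(k-l)\alpha_n}<\infty$. Its dual is identified with the sequence space $(\Lambda_\infty(\alpha))'=\{y=(y_n)_{n\in\mathbb{N}}: \sup_n|y_n|e^{-k\alpha_n}<\infty\text{ for some }k\in\mathbb{N}\}$. $e_n$ is the sequence with $1$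 in the $n$-th place and $0$ elsewhere. A linear map $T:E\to F$ of Fréchet spaces is compact if $T(U)$ is precompact in $F$ for some neighborhood $U$ of zero in $E$; saying that the operator below is compact includes that it is well-defined. A one-sided sequence $(\eta_0,\eta_1,\eta_2,\dots)$ is regarded as an element of a sequence space indexed by $\mathbb{N}$ by letting its $n$-th coordinate be $\eta_{n-1}$. For such $\eta$ let $\hat T_\eta e_n=\sum_{j=n}^\infty \eta_{j-n}e_j$ and $\check T_\eta e_n=\sum_{j=1}^n\eta_{n-j}e_j$, extended to $x=\sum_n x_ne_n$ by $\hat T_\eta x=\sum_n x_n\hat T_\eta e_n$, $\check T_\eta x=\sum_n x_n\check T_\eta e_n$; well-defined means that the images of the $e_n$ lie in the target space and the series converge in the target space for every $x$ in the domain. Toeplitz operator: for $\theta=(\theta_j)_{j\in\mathbb{Z}}$ write $\theta_0=\theta_0'+\theta_0''$ with $\theta_0',\theta_0''$ both non-zero, and set $\hat\theta=(\theta_0',\theta_1,\theta_2,\dots)$, $\check\theta=(\theta_0'',\theta_{-1},\theta_{-2},\dots)$. Then $T_\theta:=\hat T_{\hat\theta}+\check T_{\check\theta}$, i.e. the operator whose matrix with respect to $(e_n)$ is the Toeplitz matrix with $(i,j)$ entry $\theta_{i-j}$. The notation $\theta\in\Lambda_\infty(\beta)\oplus(\Lambda_\infty(\alpha))'$ means $\hat\theta\in\Lambda_\infty(\beta)$ and $\check\theta\in(\Lambda_\infty(\alpha))'$. Standing assumption: each of the symbol sequences $\hat\theta$ and $\check\theta$ has infinitely many non-zero terms. *)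

theory Defs
  imports "HOL-Analysis.Analysis"
begin

text \<open>
  Sequences indexed by the positive integers are functions on \<open>nat\<close> of which only the values
  at \<open>n \<ge> 1\<close> matter; elements of sequence spaces are normalised to vanish at index \<open>0\<close>.
  The scalars form a type \<open>'a :: {real_normed_field, banach}\<close>, which covers exactly the real and
  the complex case.
\<close>

section \<open>Spaces of sequences with a sequence of seminorms\<close>

text \<open>
  Below, \<open>E\<close> is a linear space of scalar sequences and \<open>p 1, p 2, \<dots>\<close> are seminorms on it
  that define its topology.
\<close>

definition seminorm_ball ::
  "(nat \<Rightarrow> 'a::minus) set \<Rightarrow> (nat \<Rightarrow> (nat \<Rightarrow> 'a) \<Rightarrow> real) \<Rightarrow> (nat \<Rightarrow> 'a) \<Rightarrow> nat \<Rightarrow> real \<Rightarrow> (nat \<Rightarrow> 'a) set"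
  where "seminorm_ball E p x k \<epsilon> = {y \<in> E. \<forall>i\<in>{1..k}. p i (\<lambda>n. y n - x n) < \<epsilon>}"

definition seminorm_topology ::
  "(nat \<Rightarrow> 'a::minus) set \<Rightarrow> (nat \<Rightarrow> (nat \<Rightarrow> 'a) \<Rightarrow> real) \<Rightarrow> (nat \<Rightarrow> 'a) topology"
  where "seminorm_topology E p =
    topology (\<lambda>S. S \<subseteq> E \<and> (\<forall>x\<in>S. \<exists>k\<ge>1. \<exists>\<epsilon>>0. seminorm_ball E p x k \<epsilon> \<subseteq> S))"

lemma openin_seminorm_topology:
  "openin (seminorm_topology E p) S \<longleftrightarrow>
     S \<subseteq> E \<and> (\<forall>x\<in>S. \<exists>k\<ge>1. \<exists>\<epsilon>>0. seminorm_ball E p x k \<epsilon> \<subseteq> S)"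
proof -
  let ?P = "\<lambda>S. S \<subseteq> E \<and> (\<forall>x\<in>S. \<exists>k\<ge>1. \<exists>\<epsilon>>0. seminorm_ball E p x k \<epsilon> \<subseteq> S)"
  have "istopology ?P"
    unfolding istopology_def
  proof (intro conjI allI impI)
    fix S T assume S: "?P S" and T: "?P T"
    show "S \<inter> T \<subseteq> E" using S by blast
    show "\<forall>x\<in>S \<inter> T. \<exists>k\<ge>1. \<exists>\<epsilon>>0. seminorm_ball E p x k \<epsilon> \<subseteq> S \<inter> T"
    proof
      fix x assume "x \<in> S \<inter> T"
      then obtain k \<epsilon> l \<delta> where *: "k \<ge> 1" "\<epsilon> > 0" "seminorm_ball E p x k \<epsilon> \<subseteq> S"
          "l \<ge> 1" "\<delta> > 0" "seminorm_ball E p x l \<delta> \<subseteq> T"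
        using S T by blast
      have "seminorm_ball E p x (max k l) (min \<epsilon> \<delta>) \<subseteq> seminorm_ball E p x k \<epsilon> \<inter> seminorm_ball E p x l \<delta>"
        by (auto simp: seminorm_ball_def)
      then have "seminorm_ball E p x (max k l) (min \<epsilon> \<delta>) \<subseteq> S \<inter> T"
        using * by blast
      moreover have "max k l \<ge> 1" "min \<epsilon> \<delta> > 0" using * by auto
      ultimately show "\<exists>k\<ge>1. \<exists>\<epsilon>>0. seminorm_ball E p x k \<epsilon> \<subseteq> S \<inter> T" by blast
    qed
  next
    fix K assume K: "\<forall>S\<in>K. ?P S"
    show "\<Union> K \<subseteq> E" using K by blast
    show "\<forall>x\<in>\<Union> K. \<exists>k\<ge>1. \<exists>\<epsilon>>0. seminorm_ball E p x k \<epsilon> \<subseteq> \<Union> K"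
    proof
      fix x assume "x \<in> \<Union> K"
      then obtain S where S: "S \<in> K" "x \<in> S" by blast
      then obtain k \<epsilon> where "k \<ge> 1" "\<epsilon> > 0" "seminorm_ball E p x k \<epsilon> \<subseteq> S" using K by blast
      with S show "\<exists>k\<ge>1. \<exists>\<epsilon>>0. seminorm_ball E p x k \<epsilon> \<subseteq> \<Union> K" by (meson Sup_upper subset_trans)
    qed
  qed
  then show ?thesis by (simp add: seminorm_topology_def)
qed

lemma topspace_seminorm_topology [simp]: "topspace (seminorm_topology E p) = E"
proof -
  have "openin (seminorm_topology E p) E"
    unfolding openin_seminorm_topology by (auto simp: seminorm_ball_def intro!: exI[of _ 1])
  moreover have "topspace (seminorm_topology E p) \<subseteq> E"
    using openin_topspace[of "seminorm_topology E p"] unfolding openin_seminorm_topology by blast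
  ultimately show ?thesis
    by (simp add: openin_subset subset_antisym)
qed

definition precompact ::
  "(nat \<Rightarrow> 'a::minus) set \<Rightarrow> (nat \<Rightarrow> (nat \<Rightarrow> 'a) \<Rightarrow> real) \<Rightarrow> (nat \<Rightarrow> 'a) set \<Rightarrow> bool"
  where "precompact E p S \<longleftrightarrow> S \<subseteq> E \<and>
    (\<forall>k\<ge>1. \<forall>\<epsilon>>0. \<exists>A. finite A \<and> A \<subseteq> E \<and> S \<subseteq> (\<Union>a\<in>A. seminorm_ball E p a k \<epsilon>))"

definition compact_operator ::
  "(nat \<Rightarrow> 'a::comm_ring_1) set \<Rightarrow> (nat \<Rightarrow> (nat \<Rightarrow> 'a) \<Rightarrow> real) \<Rightarrow>
   (nat \<Rightarrow> 'a) set \<Rightarrow> (nat \<Rightarrow> (nat \<Rightarrow> 'a) \<Rightarrow> real) \<Rightarrow> ((nat \<Rightarrow> 'a) \<Rightarrow> nat \<Rightarrow> 'a) \<Rightarrow> bool"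
  where "compact_operator E p F q T \<longleftrightarrow>
    (\<forall>x\<in>E. T x \<in> F) \<and>
    (\<forall>x\<in>E. \<forall>y\<in>E. T (\<lambda>n. x n + y n) = (\<lambda>n. T x n + T y n)) \<and>
    (\<forall>c. \<forall>x\<in>E. T (\<lambda>n. c * x n) = (\<lambda>n. c * T x n)) \<and>
    (\<exists>U. openin (seminorm_topology E p) U \<and> (\<lambda>_. 0) \<in> U \<and> precompact F q (T ` U))"

definition linear_functional :: "(nat \<Rightarrow> 'a::comm_ring_1) set \<Rightarrow> ((nat \<Rightarrow> 'a) \<Rightarrow> 'a) \<Rightarrow> bool"
  where "linear_functional E f \<longleftrightarrow>
    (\<forall>x\<in>E. \<forall>y\<in>E. f (\<lambda>n. x n + y n) = f x + f y) \<and>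
    (\<forall>c. \<forall>x\<in>E. f (\<lambda>n. c * x n) = c * f x)"

text \<open>
  Nuclearity of the space with the increasing fundamental system of seminorms \<open>p 1, p 2, \<dots>\<close>:
  for each \<open>k\<close> there is \<open>l > k\<close> such that the linking map from the local Banach space of \<open>p l\<close> to
  that of \<open>p k\<close> is nuclear, i.e. a sum \<open>\<Sum>j. f j \<otimes> y j\<close> with \<open>\<Sum>j. \<parallel>f j\<parallel> * \<parallel>y j\<parallel> < \<infinity>\<close>, where
  \<open>a j\<close> bounds the dual norm of \<open>f j\<close> with respect to \<open>p l\<close>. Since \<open>E\<close> is dense in the local
  Banach space of \<open>p k\<close>, and each element of the latter is an absolutely convergent series of
  elements of \<open>E\<close>, one may take the \<open>y j\<close> in \<open>E\<close>.
\<close>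

definition nuclear_space ::
  "(nat \<Rightarrow> 'a::{real_normed_field, banach}) set \<Rightarrow> (nat \<Rightarrow> (nat \<Rightarrow> 'a) \<Rightarrow> real) \<Rightarrow> bool"
  where "nuclear_space E p \<longleftrightarrow>
    (\<forall>k\<ge>1. \<exists>l>k. \<exists>(f :: nat \<Rightarrow> (nat \<Rightarrow> 'a) \<Rightarrow> 'a) (y :: nat \<Rightarrow> nat \<Rightarrow> 'a) (a :: nat \<Rightarrow> real).
       (\<forall>j. linear_functional E (f j) \<and> 0 \<le> a j \<and> (\<forall>x\<in>E. norm (f j x) \<le> a j * p l x)) \<and>
       (\<forall>j. y j \<in> E) \<and>
       summable (\<lambda>j. a j * p k (y j)) \<and>
       (\<forall>x\<in>E. (\<lambda>N. p k (\<lambda>n. x n - (\<Sum>j<N. f j x * y j n))) \<longlonglongrightarrow> 0))"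

section \<open>Power series spaces of infinite type\<close>

definition exponent_sequence :: "(nat \<Rightarrow> real) \<Rightarrow> bool"
  where "exponent_sequence \<alpha> \<longleftrightarrow>
    (\<forall>n\<ge>1. 0 \<le> \<alpha> n) \<and> mono_on {1..} \<alpha> \<and> filterlim \<alpha> at_top sequentially"

definition stable :: "(nat \<Rightarrow> real) \<Rightarrow> bool"
  where "stable \<alpha> \<longleftrightarrow> (\<exists>M. \<forall>n\<ge>1. \<alpha> (2 * n) \<le> M * \<alpha> n)"

definition Lambda_norm :: "(nat \<Rightarrow> real) \<Rightarrow> nat \<Rightarrow> (nat \<Rightarrow> 'a::real_normed_vector) \<Rightarrow> real"
  where "Lambda_norm \<alpha> k x = (\<Sum>\<^sub>\<infinity>n\<in>{1..}. norm (x n) * exp (real k * \<alpha> n))"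

definition Lambda_inf :: "(nat \<Rightarrow> real) \<Rightarrow> (nat \<Rightarrow> 'a::real_normed_vector) set"
  where "Lambda_inf \<alpha> =
    {x. x 0 = 0 \<and> (\<forall>k\<ge>1. (\<lambda>n. norm (x n) * exp (real k * \<alpha> n)) summable_on {1..})}"

abbreviation Lambda_topology :: "(nat \<Rightarrow> real) \<Rightarrow> (nat \<Rightarrow> 'a::real_normed_vector) topology"
  where "Lambda_topology \<alpha> \<equiv> seminorm_topology (Lambda_inf \<alpha>) (Lambda_norm \<alpha>)"

definition Lambda_dual :: "(nat \<Rightarrow> real) \<Rightarrow> (nat \<Rightarrow> 'a::real_normed_vector) set"
  where "Lambda_dual \<alpha> =
    {y. y 0 = 0 \<and> (\<exists>k\<ge>1. bdd_above ((\<lambda>n. norm (y n) * exp (- real k * \<alpha> n)) ` {1..}))}"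

definition unit_seq :: "nat \<Rightarrow> nat \<Rightarrow> 'a::zero_neq_one"
  where "unit_seq n = (\<lambda>j. if j = n then 1 else 0)"

lemma Lambda_norm_coord_sum_le:
  assumes "x \<in> Lambda_inf \<alpha>" "k \<ge> 1" "finite F" "F \<subseteq> {1..}"
  shows "(\<Sum>n\<in>F. norm (x n) * exp (real k * \<alpha> n)) \<le> Lambda_norm \<alpha> k x"
  unfolding Lambda_norm_def
  by (rule finite_sum_le_infsum) (use assms in \<open>auto simp: Lambda_inf_def\<close>)

lemma Lambda_inf_add:
  assumes "x \<in> Lambda_inf \<alpha>" "y \<in> Lambda_inf \<alpha>"
  shows "(\<lambda>n. x n + y n) \<in> Lambda_inf \<alpha>"
proof -
  have "(\<lambda>n. norm (x n + y n) * exp (real k * \<alpha> n)) summable_on {1..}" if "k \<ge> 1" for k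
  proof (rule summable_on_comparison_test)
    show "(\<lambda>n. norm (x n) * exp (real k * \<alpha> n) + norm (y n) * exp (real k * \<alpha> n)) summable_on {1..}"
      using assms that by (intro summable_on_add) (auto simp: Lambda_inf_def)
    show "norm (x n + y n) * exp (real k * \<alpha> n)
        \<le> norm (x n) * exp (real k * \<alpha> n) + norm (y n) * exp (real k * \<alpha> n)" for n
      by (metis distrib_right exp_ge_zero mult_right_mono norm_triangle_ineq)
  qed auto
  then show ?thesis using assms by (simp add: Lambda_inf_def)
qed

lemma Lambda_inf_scale:
  fixes x :: "nat \<Rightarrow> 'a::real_normed_field"
  assumes "x \<in> Lambda_inf \<alpha>"
  shows "(\<lambda>n. c * x n) \<in> Lambda_inf \<alpha>"
  using assms by (auto simp: Lambda_inf_def norm_mult mult.assoc intro!: summable_on_cmult_right)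

lemma Lambda_inf_zero: "(\<lambda>_. 0) \<in> Lambda_inf \<alpha>"
  by (simp add: Lambda_inf_def)

lemma Lambda_inf_diff_sum:
  fixes x :: "nat \<Rightarrow> 'a::real_normed_field" and y :: "nat \<Rightarrow> nat \<Rightarrow> 'a" and N :: nat
  assumes "x \<in> Lambda_inf \<alpha>" "\<And>j. y j \<in> Lambda_inf \<alpha>"
  shows "(\<lambda>n. x n - (\<Sum>j<N. c j * y j n)) \<in> Lambda_inf \<alpha>"
proof (induction N)
  case 0
  then show ?case using assms by simp
next
  case (Suc N)
  from Lambda_inf_add[OF Suc Lambda_inf_scale[OF assms(2)[of N], of "- c N"]]
  show ?case by (simp add: algebra_simps)
qed

lemma unit_seq_mem:
  assumes "n \<ge> 1"
  shows "(unit_seq n :: nat \<Rightarrow> 'a::real_normed_field) \<in> Lambda_inf \<alpha>"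
proof -
  have "(\<lambda>j. norm (unit_seq n j :: 'a) * exp (real k * \<alpha> j)) summable_on {1..}" for k
    by (rule summable_on_cong_neutral[where S = "{n}", THEN iffD1])
       (use assms in \<open>auto simp: unit_seq_def\<close>)
  then show ?thesis using assms by (simp add: Lambda_inf_def unit_seq_def)
qed

lemma Lambda_norm_unit_seq:
  assumes "n \<ge> 1"
  shows "Lambda_norm \<alpha> k (unit_seq n :: nat \<Rightarrow> 'a::real_normed_field) = exp (real k * \<alpha> n)"
proof -
  have "Lambda_norm \<alpha> k (unit_seq n :: nat \<Rightarrow> 'a)
      = infsum (\<lambda>j. norm (unit_seq n j :: 'a) * exp (real k * \<alpha> j)) {n}"
    unfolding Lambda_norm_def
    by (rule infsum_cong_neutral) (use assms in \<open>auto simp: unit_seq_def\<close>)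
  then show ?thesis by (simp add: unit_seq_def)
qed

lemma range_Suc_eq: "range Suc = {1..}"
  by (auto simp: image_iff) (metis One_nat_def Suc_le_D)

text \<open>The Grothendieck--Pietsch criterion:\<close>

lemma nuclear_Lambda_inf_iff:
  "nuclear_space (Lambda_inf \<alpha> :: (nat \<Rightarrow> 'a::{real_normed_field, banach}) set) (Lambda_norm \<alpha>) \<longleftrightarrow>
     (\<forall>k\<ge>1. \<exists>l>k. (\<lambda>n. exp ((real k - real l) * \<alpha> n)) summable_on {1..})"
  (is "?N \<longleftrightarrow> ?S")
proof
  assume N: ?N
  show ?S
  proof (intro allI impI)
    fix k :: nat assume k: "k \<ge> 1"
    let ?E = "Lambda_inf \<alpha> :: (nat \<Rightarrow> 'a) set"
    obtain l and f :: "nat \<Rightarrow> (nat \<Rightarrow> 'a) \<Rightarrow> 'a" and a and y :: "nat \<Rightarrow> nat \<Rightarrow> 'a" where l: "l > k"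
      and "\<forall>j. linear_functional ?E (f j) \<and> 0 \<le> a j \<and> (\<forall>x\<in>?E. norm (f j x) \<le> a j * Lambda_norm \<alpha> l x)"
      and "\<forall>j. y j \<in> ?E" and s: "summable (\<lambda>j. a j * Lambda_norm \<alpha> k (y j))"
      and "\<forall>x\<in>?E. (\<lambda>N. Lambda_norm \<alpha> k (\<lambda>n. x n - (\<Sum>j<N. f j x * y j n))) \<longlonglongrightarrow> 0"
      using N[unfolded nuclear_space_def, rule_format, OF k] by (elim exE conjE) (rule that)
    then have f: "\<And>j. 0 \<le> a j" "\<And>j x. x \<in> ?E \<Longrightarrow> norm (f j x) \<le> a j * Lambda_norm \<alpha> l x"
      and y: "\<And>j. y j \<in> ?E"
      and lim: "\<And>x. x \<in> ?E \<Longrightarrow>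
        (\<lambda>N. Lambda_norm \<alpha> k (\<lambda>n. x n - (\<Sum>j<N. f j x * y j n))) \<longlonglongrightarrow> 0"
      by blast+
    let ?B = "\<Sum>j. a j * Lambda_norm \<alpha> k (y j)"
    define d where "d = (\<lambda>N n. Lambda_norm \<alpha> k
        (\<lambda>i. unit_seq n i - (\<Sum>j<N. f j (unit_seq n) * y j i)))"
    have pos: "Lambda_norm \<alpha> k x \<ge> 0" for x :: "nat \<Rightarrow> 'a"
      unfolding Lambda_norm_def by (intro infsum_nonneg) auto
    have bound: "(\<Sum>n\<in>F. exp ((real k - real l) * \<alpha> n)) \<le> ?B" if F: "finite F" "F \<subseteq> {1..}" for F
    proof -
      have pt: "exp ((real k - real l) * \<alpha> n) \<le>
          exp (- real l * \<alpha> n) * d N n + (\<Sum>j<N. a j * (norm (y j n) * exp (real k * \<alpha> n)))"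
        if n: "n \<ge> 1" for n N
      proof -
        have u: "unit_seq n \<in> ?E" using n by (rule unit_seq_mem)
        let ?s = "\<Sum>j<N. f j (unit_seq n) * y j n"
        have "norm (1 - ?s) * exp (real k * \<alpha> n) \<le> d N n"
          using Lambda_norm_coord_sum_le[OF Lambda_inf_diff_sum[where N = N and c = "\<lambda>j. f j (unit_seq n)", OF u y] k, of "{n}"] n
          by (simp add: d_def unit_seq_def)
        moreover have "norm ?s \<le> (\<Sum>j<N. a j * exp (real l * \<alpha> n) * norm (y j n))"
        proof (rule order_trans[OF norm_sum], rule sum_mono)
          fix j
          have "norm (f j (unit_seq n)) \<le> a j * exp (real l * \<alpha> n)"
            using f(2)[OF u] Lambda_norm_unit_seq[OF n, where 'a = 'a] by metis
          then show "norm (f j (unit_seq n) * y j n) \<le> a j * exp (real l * \<alpha> n) * norm (y j n)"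
            by (simp add: norm_mult mult_right_mono)
        qed
        moreover have "1 \<le> norm (1 - ?s) + norm ?s"
          using norm_triangle_ineq[of "1 - ?s" ?s] by simp
        ultimately have "exp (real k * \<alpha> n) \<le>
            d N n + (\<Sum>j<N. a j * exp (real l * \<alpha> n) * norm (y j n)) * exp (real k * \<alpha> n)"
        proof -
          assume 1: "norm (1 - ?s) * exp (real k * \<alpha> n) \<le> d N n"
            and 2: "norm ?s \<le> (\<Sum>j<N. a j * exp (real l * \<alpha> n) * norm (y j n))"
            and 3: "1 \<le> norm (1 - ?s) + norm ?s"
          have "1 * exp (real k * \<alpha> n) \<le> (norm (1 - ?s) + norm ?s) * exp (real k * \<alpha> n)"
            using 3 by (intro mult_right_mono) auto
          also have "\<dots> = norm (1 - ?s) * exp (real k * \<alpha> n) + norm ?s * exp (real k * \<alpha> n)"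
            by (rule distrib_right)
          also have "\<dots> \<le> d N n + (\<Sum>j<N. a j * exp (real l * \<alpha> n) * norm (y j n)) * exp (real k * \<alpha> n)"
            using 1 2 by (intro add_mono mult_right_mono) auto
          finally show ?thesis by simp
        qed
        then have "exp (- real l * \<alpha> n) * exp (real k * \<alpha> n) \<le> exp (- real l * \<alpha> n) *
            (d N n + (\<Sum>j<N. a j * exp (real l * \<alpha> n) * norm (y j n)) * exp (real k * \<alpha> n))"
          by (intro mult_left_mono) auto
        moreover have "exp (- real l * \<alpha> n) *
            ((\<Sum>j<N. a j * exp (real l * \<alpha> n) * norm (y j n)) * exp (real k * \<alpha> n)) =
            (\<Sum>j<N. a j * (norm (y j n) * exp (real k * \<alpha> n)))"
          by (simp add: sum_distrib_left sum_distrib_right exp_minus field_simps)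
        ultimately show ?thesis
          by (simp add: distrib_left flip: exp_add) (simp add: algebra_simps)
      qed
      have le: "(\<Sum>n\<in>F. exp ((real k - real l) * \<alpha> n)) \<le> (\<Sum>n\<in>F. exp (- real l * \<alpha> n) * d N n) + ?B" for N
      proof -
        have "(\<Sum>n\<in>F. exp ((real k - real l) * \<alpha> n)) \<le>
          (\<Sum>n\<in>F. exp (- real l * \<alpha> n) * d N n + (\<Sum>j<N. a j * (norm (y j n) * exp (real k * \<alpha> n))))"
          using F by (intro sum_mono pt) auto
        also have "\<dots> = (\<Sum>n\<in>F. exp (- real l * \<alpha> n) * d N n) +
            (\<Sum>j<N. a j * (\<Sum>n\<in>F. norm (y j n) * exp (real k * \<alpha> n)))"
          by (simp add: sum.distrib sum_distrib_left sum.swap[of _ F])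
        also have "(\<Sum>j<N. a j * (\<Sum>n\<in>F. norm (y j n) * exp (real k * \<alpha> n)))
            \<le> (\<Sum>j<N. a j * Lambda_norm \<alpha> k (y j))"
          using f(1) F k y by (intro sum_mono mult_left_mono Lambda_norm_coord_sum_le) auto
        also have "\<dots> \<le> ?B"
          using f(1) pos by (intro sum_le_suminf s) auto
        finally show ?thesis by simp
      qed
      have "(\<lambda>N. (\<Sum>n\<in>F. exp (- real l * \<alpha> n) * d N n) + ?B) \<longlonglongrightarrow> (\<Sum>n\<in>F. exp (- real l * \<alpha> n) * 0) + ?B"
        unfolding d_def using F
        by (intro tendsto_intros lim unit_seq_mem) auto
      then show ?thesis
        using le by (intro LIMSEQ_le_const[where X = "\<lambda>N. (\<Sum>n\<in>F. exp (- real l * \<alpha> n) * d N n) + ?B"]) auto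
    qed
    have "(\<lambda>n. exp ((real k - real l) * \<alpha> n)) summable_on {1..}"
      by (rule nonneg_bdd_above_summable_on) (use bound in \<open>auto intro!: bdd_aboveI2[where M = ?B]\<close>)
    with l show "\<exists>l>k. (\<lambda>n. exp ((real k - real l) * \<alpha> n)) summable_on {1..}" by blast
  qed
next
  assume S: ?S
  show ?N
    unfolding nuclear_space_def
  proof (intro allI impI)
    fix k :: nat assume k: "k \<ge> 1"
    let ?E = "Lambda_inf \<alpha> :: (nat \<Rightarrow> 'a) set"
    obtain l where l: "l > k" and s: "(\<lambda>n. exp ((real k - real l) * \<alpha> n)) summable_on {1..}"
      using S k by blast
    define f where "f = (\<lambda>j (x :: nat \<Rightarrow> 'a). x (Suc j))"
    define y where "y = (\<lambda>j. unit_seq (Suc j) :: nat \<Rightarrow> 'a)"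
    define a where "a = (\<lambda>j. exp (- real l * \<alpha> (Suc j)))"
    have "linear_functional ?E (f j)" for j
      by (simp add: linear_functional_def f_def)
    moreover have "0 \<le> a j" for j by (simp add: a_def)
    moreover have "norm (f j x) \<le> a j * Lambda_norm \<alpha> l x" if "x \<in> ?E" for j x
    proof -
      have "norm (x (Suc j)) * exp (real l * \<alpha> (Suc j)) \<le> Lambda_norm \<alpha> l x"
        using Lambda_norm_coord_sum_le[OF that, of l "{Suc j}"] k l by simp
      then show ?thesis by (simp add: f_def a_def exp_minus field_simps)
    qed
    moreover have "y j \<in> ?E" for j by (simp add: y_def unit_seq_mem)
    moreover have "summable (\<lambda>j. a j * Lambda_norm \<alpha> k (y j))"
    proof -
      have "(\<lambda>j. a j * Lambda_norm \<alpha> k (y j)) = (\<lambda>n. exp ((real k - real l) * \<alpha> n)) \<circ> Suc"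
        by (auto simp: fun_eq_iff a_def y_def Lambda_norm_unit_seq algebra_simps simp flip: exp_add)
      moreover have "((\<lambda>n. exp ((real k - real l) * \<alpha> n)) \<circ> Suc) summable_on UNIV"
        by (subst summable_on_reindex[symmetric]) (use s in \<open>simp_all add: range_Suc_eq\<close>)
      ultimately show ?thesis by (metis summable_on_imp_summable)
    qed
    moreover have "(\<lambda>N. Lambda_norm \<alpha> k (\<lambda>n. x n - (\<Sum>j<N. f j x * y j n))) \<longlonglongrightarrow> 0" if x: "x \<in> ?E" for x
    proof -
      let ?g = "\<lambda>n. norm (x n) * exp (real k * \<alpha> n)"
      have g: "?g summable_on {1..}" using x k by (simp add: Lambda_inf_def)
      have g': "(\<lambda>j. ?g (Suc j)) summable_on UNIV"
        using g summable_on_reindex[of Suc UNIV ?g] by (simp add: o_def range_Suc_eq)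
      have inf: "infsum ?g {1..} = (\<Sum>j. ?g (Suc j))"
        using infsum_reindex[of Suc UNIV ?g] sums_unique[OF has_sum_imp_sums[OF has_sum_infsum[OF g']]]
        by (simp add: o_def range_Suc_eq)
      have eq: "Lambda_norm \<alpha> k (\<lambda>n. x n - (\<Sum>j<N. f j x * y j n)) = infsum ?g {1..} - (\<Sum>j<N. ?g (Suc j))" for N
      proof -
        have fin: "(\<Sum>j<N. f j x * y j n) = (if n \<in> {1..N} then x n else 0)" for n
        proof (cases n)
          case 0 then show ?thesis by (simp add: f_def y_def unit_seq_def)
        next
          case (Suc m)
          have "(\<Sum>j<N. f j x * y j n) = (\<Sum>j<N. if j = m then x (Suc m) else 0)"
            by (rule sum.cong) (auto simp: f_def y_def unit_seq_def Suc)
          then show ?thesis by (auto simp: Suc)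
        qed
        have "Lambda_norm \<alpha> k (\<lambda>n. x n - (\<Sum>j<N. f j x * y j n)) = infsum ?g ({1..} - {1..N})"
          unfolding Lambda_norm_def fin by (rule infsum_cong_neutral) auto
        also have "\<dots> = infsum ?g {1..} - infsum ?g {1..N}"
          using infsum_Un_disjoint[of ?g "{1..} - {1..N}" "{1..N}"] summable_on_subset_banach[OF g, of "{1..} - {1..N}"]
          by (simp add: Un_absorb2 Int_commute)
        also have "infsum ?g {1..N} = (\<Sum>j<N. ?g (Suc j))"
          by (simp add: sum.atLeast1_atMost_eq)
        finally show ?thesis .
      qed
      have "(\<lambda>N. \<Sum>j<N. ?g (Suc j)) \<longlonglongrightarrow> infsum ?g {1..}"
        using summable_LIMSEQ[OF summable_on_imp_summable[OF g']] inf by simp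
      then have "(\<lambda>N. infsum ?g {1..} - (\<Sum>j<N. ?g (Suc j))) \<longlonglongrightarrow> infsum ?g {1..} - infsum ?g {1..}"
        by (intro tendsto_intros)
      then show ?thesis by (simp add: eq)
    qed
    ultimately show "\<exists>l>k. \<exists>(f :: nat \<Rightarrow> (nat \<Rightarrow> 'a) \<Rightarrow> 'a) (y :: nat \<Rightarrow> nat \<Rightarrow> 'a) (a :: nat \<Rightarrow> real).
       (\<forall>j. linear_functional ?E (f j) \<and> 0 \<le> a j \<and> (\<forall>x\<in>?E. norm (f j x) \<le> a j * Lambda_norm \<alpha> l x)) \<and>
       (\<forall>j. y j \<in> ?E) \<and>
       summable (\<lambda>j. a j * Lambda_norm \<alpha> k (y j)) \<and>
       (\<forall>x\<in>?E. (\<lambda>N. Lambda_norm \<alpha> k (\<lambda>n. x n - (\<Sum>j<N. f j x * y j n))) \<longlonglongrightarrow> 0)"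
      using l by blast
  qed
qed

section \<open>Toeplitz operators\<close>

text \<open>
  In this section \<open>c n\<close> is the (formal) image of the unit vector \<open>unit_seq n\<close>, and \<open>F\<close> is the
  target space as a topology.
\<close>

definition series_converges_to ::
  "(nat \<Rightarrow> 'a::comm_ring_1) topology \<Rightarrow> (nat \<Rightarrow> nat \<Rightarrow> 'a) \<Rightarrow> (nat \<Rightarrow> 'a) \<Rightarrow> (nat \<Rightarrow> 'a) \<Rightarrow> bool"
  where "series_converges_to F c x y \<longleftrightarrow>
    limitin F (\<lambda>N j. \<Sum>n=1..N. x n * c n j) y sequentially"

definition series_well_defined ::
  "(nat \<Rightarrow> 'a::comm_ring_1) set \<Rightarrow> (nat \<Rightarrow> 'a) topology \<Rightarrow> (nat \<Rightarrow> nat \<Rightarrow> 'a) \<Rightarrow> bool"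
  where "series_well_defined E F c \<longleftrightarrow>
    (\<forall>n\<ge>1. c n \<in> topspace F) \<and> (\<forall>x\<in>E. \<exists>y. series_converges_to F c x y)"

definition series_operator ::
  "(nat \<Rightarrow> 'a::comm_ring_1) topology \<Rightarrow> (nat \<Rightarrow> nat \<Rightarrow> 'a) \<Rightarrow> (nat \<Rightarrow> 'a) \<Rightarrow> nat \<Rightarrow> 'a"
  where "series_operator F c x = (THE y. series_converges_to F c x y)"

text \<open>\<open>T_hat_unit \<eta> n = (\<Sum>j\<ge>n. \<eta> (j - n) e_j)\<close> and \<open>T_check_unit \<eta> n = (\<Sum>j=1..n. \<eta> (n - j) e_j)\<close>:\<close>

definition T_hat_unit :: "(nat \<Rightarrow> 'a::zero) \<Rightarrow> nat \<Rightarrow> nat \<Rightarrow> 'a"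
  where "T_hat_unit \<eta> n = (\<lambda>j. if n \<le> j then \<eta> (j - n) else 0)"

definition T_check_unit :: "(nat \<Rightarrow> 'a::zero) \<Rightarrow> nat \<Rightarrow> nat \<Rightarrow> 'a"
  where "T_check_unit \<eta> n = (\<lambda>j. if 1 \<le> j \<and> j \<le> n then \<eta> (n - j) else 0)"

text \<open>The one-sided sequence \<open>\<eta> 0, \<eta> 1, \<dots>\<close> as a sequence indexed by the positive integers:\<close>

definition shift_seq :: "(nat \<Rightarrow> 'a::zero) \<Rightarrow> nat \<Rightarrow> 'a"
  where "shift_seq \<eta> = (\<lambda>n. if n = 0 then 0 else \<eta> (n - 1))"

text \<open>The two halves of \<open>\<theta>\<close>, where \<open>\<theta> 0 = t' + t''\<close> is split between them:\<close>

definition theta_hat :: "(int \<Rightarrow> 'a) \<Rightarrow> 'a \<Rightarrow> nat \<Rightarrow> 'a"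
  where "theta_hat \<theta> t' = (\<lambda>j. if j = 0 then t' else \<theta> (int j))"

definition theta_check :: "(int \<Rightarrow> 'a) \<Rightarrow> 'a \<Rightarrow> nat \<Rightarrow> 'a"
  where "theta_check \<theta> t'' = (\<lambda>j. if j = 0 then t'' else \<theta> (- int j))"

definition toeplitz_well_defined ::
  "(nat \<Rightarrow> 'a::comm_ring_1) set \<Rightarrow> (nat \<Rightarrow> 'a) topology \<Rightarrow> (int \<Rightarrow> 'a) \<Rightarrow> 'a \<Rightarrow> 'a \<Rightarrow> bool"
  where "toeplitz_well_defined E F \<theta> t' t'' \<longleftrightarrow>
    series_well_defined E F (T_hat_unit (theta_hat \<theta> t')) \<and>
    series_well_defined E F (T_check_unit (theta_check \<theta> t''))"

definition toeplitz ::
  "(nat \<Rightarrow> 'a::comm_ring_1) topology \<Rightarrow> (int \<Rightarrow> 'a) \<Rightarrow> 'a \<Rightarrow> 'a \<Rightarrow> (nat \<Rightarrow> 'a) \<Rightarrow> nat \<Rightarrow> 'a"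
  where "toeplitz F \<theta> t' t'' x =
    (\<lambda>j. series_operator F (T_hat_unit (theta_hat \<theta> t')) x j +
         series_operator F (T_check_unit (theta_check \<theta> t'')) x j)"

end

theory Submission
  imports Defs
begin

text \<open>
  The operator is compact because it maps a neighbourhood of zero to a bounded set, and bounded sets of
  a power series space are precompact.

  For boundedness, consider the images of the unit vectors, i.e. the columns of the two triangular
  halves of the matrix. It suffices that there is one \<open>M\<close> such that for every
  \<open>k\<close> the \<open>k\<close>-th norm of the \<open>n\<close>-th column is at most a constant
  times \<open>exp (M * \<alpha> n)\<close> (\<open>bounded_columns\<close>): then the series over the
  columns converges and satisfies
  \<open>Lambda_norm \<beta> k (T x) \<le> C * Lambda_norm \<alpha> M x\<close>
  (\<open>column_series_converges\<close>, \<open>column_sum_bound\<close>), so the unit ball of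
  \<open>Lambda_norm \<alpha> M\<close> has bounded image. The growth condition provides an
  \<open>m\<close> such that \<open>exp (m * \<alpha> n)\<close> dominates all
  \<open>exp (k * \<beta> n)\<close>. In the lower triangular half the \<open>n\<close>-th column is a
  shift of the symbol, and stability of \<open>\<beta>\<close> bounds the effect of the shift by a
  factor \<open>exp (K * \<beta> n)\<close> and a larger norm of the symbol
  (\<open>bounded_columns_T_hat\<close>). In the upper triangular half the \<open>n\<close>-th column
  has \<open>n\<close> entries of size at most \<open>D * exp (p * \<alpha> n)\<close>, and nuclearity
  bounds their number \<open>n\<close> by a constant times \<open>exp (q * \<alpha> n)\<close>
  (\<open>bounded_columns_T_check\<close>).

  Precompactness of bounded sets (\<open>precompact_bounded\<close>) comes down to finitely many
  coordinates, since the weights tend to infinity, and then to the compactness of balls in the scalar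
  field (\<open>compact_cball_real_normed_field\<close>). The scalars are only given as a field with a
  multiplicative norm over the reals, so a version of the Gelfand--Mazur theorem is proved first
  (\<open>quadratic_over_reals\<close>): each scalar is a root of a real quadratic polynomial, and
  therefore the field has dimension at most two.
\<close>

section \<open>Compactness of scalar balls\<close>

text \<open>
  Over the complex numbers the left-hand side is
  \<open>(Y\<^sup>2 - z\<^sup>2) * (Y\<^sup>2 - w\<^sup>2)\<close>, where \<open>w\<close> is the
  complex conjugate of \<open>z\<close> and \<open>z\<^sup>2 = - u - i * v\<close>. Grouping the four
  linear factors into the pairs with roots \<open>- z, - w\<close> and \<open>z, w\<close> gives two
  real quadratics; here \<open>z = c + i * d\<close>, so that \<open>c\<close> and \<open>d\<close> are
  given by the half-angle formulas and no complex number has to occur.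
\<close>

lemma biquadratic_factorization:
  fixes Y :: "'a::real_normed_field" and u v :: real
  shows "\<exists>c d :: real. (Y\<^sup>2 + of_real u)\<^sup>2 + (of_real v)\<^sup>2 =
    ((Y + of_real c)\<^sup>2 + (of_real d)\<^sup>2) * ((Y - of_real c)\<^sup>2 + (of_real d)\<^sup>2)"
proof -
  define R where "R = sqrt (u\<^sup>2 + v\<^sup>2)"
  define c where "c = sqrt ((R - u) / 2)"
  define d where "d = sqrt ((R + u) / 2)"
  have R: "\<bar>u\<bar> \<le> R" "R\<^sup>2 = u\<^sup>2 + v\<^sup>2"
    by (simp_all add: R_def real_le_rsqrt)
  have c: "c\<^sup>2 = (R - u) / 2" and d: "d\<^sup>2 = (R + u) / 2"
    using R(1) by (simp_all add: c_def d_def)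
  have "u = d\<^sup>2 - c\<^sup>2" "u\<^sup>2 + v\<^sup>2 = (c\<^sup>2 + d\<^sup>2)\<^sup>2"
    unfolding c d R(2)[symmetric] by (simp_all add: field_simps)
  then have "(of_real u :: 'a) = of_real (d\<^sup>2 - c\<^sup>2)"
      "(of_real (u\<^sup>2 + v\<^sup>2) :: 'a) = of_real ((c\<^sup>2 + d\<^sup>2)\<^sup>2)"
    by simp_all
  then have *: "(of_real u :: 'a) = (of_real d)\<^sup>2 - (of_real c)\<^sup>2"
      "(of_real u :: 'a)\<^sup>2 + (of_real v)\<^sup>2 = ((of_real c)\<^sup>2 + (of_real d)\<^sup>2)\<^sup>2"
    by simp_all
  have "(Y\<^sup>2 + of_real u)\<^sup>2 + (of_real v)\<^sup>2 = Y^4 + 2 * of_real u * Y\<^sup>2 + ((of_real u)\<^sup>2 + (of_real v)\<^sup>2)"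
    by algebra
  also have "\<dots> = Y^4 + 2 * ((of_real d)\<^sup>2 - (of_real c)\<^sup>2) * Y\<^sup>2 + ((of_real c)\<^sup>2 + (of_real d)\<^sup>2)\<^sup>2"
    unfolding *(2) unfolding *(1) by simp
  also have "\<dots> = ((Y + of_real c)\<^sup>2 + (of_real d)\<^sup>2) * ((Y - of_real c)\<^sup>2 + (of_real d)\<^sup>2)"
    by algebra
  finally show ?thesis by blast
qed

text \<open>
  Read \<open>(p + u)\<^sup>2 + v\<^sup>2\<close> as the product of \<open>p + z\<close> and
  \<open>p + w\<close> for the conjugate complex numbers \<open>z\<close> and \<open>w\<close> with real
  part \<open>u\<close> and imaginary parts \<open>v\<close> and \<open>- v\<close>. The property says
  that no complex shift makes \<open>p\<close> smaller, in a form that makes sense in a field without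
  imaginary unit. Shifts by all complex numbers, and not only by the real ones, are needed for the
  property to survive squaring.
\<close>

definition shift_minimal :: "'a::real_normed_field \<Rightarrow> bool"
  where "shift_minimal p \<longleftrightarrow> (\<forall>u v. (norm p)\<^sup>2 \<le> norm ((p + of_real u)\<^sup>2 + (of_real v)\<^sup>2))"

lemma shift_minimal_power2:
  assumes "shift_minimal p"
  shows "shift_minimal (p\<^sup>2)"
  unfolding shift_minimal_def
proof (intro allI)
  fix u v
  obtain c d where cd: "(p\<^sup>2 + of_real u)\<^sup>2 + (of_real v)\<^sup>2 =
      ((p + of_real c)\<^sup>2 + (of_real d)\<^sup>2) * ((p - of_real c)\<^sup>2 + (of_real d)\<^sup>2)"
    using biquadratic_factorization by blast
  have "(norm p)\<^sup>2 * (norm p)\<^sup>2 \<le> norm ((p + of_real c)\<^sup>2 + (of_real d)\<^sup>2) * norm ((p + of_real (- c))\<^sup>2 + (of_real d)\<^sup>2)"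
    by (intro mult_mono assms[unfolded shift_minimal_def, rule_format]) auto
  then show "(norm (p\<^sup>2))\<^sup>2 \<le> norm ((p\<^sup>2 + of_real u)\<^sup>2 + (of_real v)\<^sup>2)"
    unfolding cd by (simp add: norm_mult norm_power power2_eq_square)
qed

lemma shift_minimal_norm_le:
  assumes "shift_minimal p"
  shows "norm p \<le> norm (p + of_real u)"
proof -
  have "(norm p)\<^sup>2 \<le> norm ((p + of_real u)\<^sup>2 + (of_real 0)\<^sup>2)"
    using assms unfolding shift_minimal_def by blast
  then have "(norm p)\<^sup>2 \<le> (norm (p + of_real u))\<^sup>2" by (simp add: norm_power)
  then show ?thesis by (rule power2_le_imp_le) simp
qed

text \<open>
  Since \<open>norm p \<le> norm (p + d)\<close>, the quotient on the left is at most the one for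
  \<open>p\<^sup>2\<close> and \<open>d\<^sup>2\<close>, because
  \<open>(p - d) * (p + d) = p\<^sup>2 - d\<^sup>2\<close>. Squaring \<open>j\<close> times and applying
  the triangle inequality at the end gives the bound. It replaces the factorization of
  \<open>p ^ n - d ^ n\<close> over the roots of unity in the classical argument.
\<close>

lemma shift_minimal_diff_le:
  assumes "shift_minimal p" "p \<noteq> 0"
  shows "norm (p - of_real d) / norm p \<le> 1 + (\<bar>d\<bar> / norm p) ^ 2 ^ j"
  using assms
proof (induction j arbitrary: p d)
  case 0
  have "norm (p - of_real d) \<le> norm p + \<bar>d\<bar>"
    using norm_triangle_ineq4[of p "of_real d"] by simp
  then show ?case using 0 by (simp add: field_simps)
next
  case (Suc j)
  have "norm (p - of_real d) * norm p \<le> norm (p - of_real d) * norm (p + of_real d)"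
    by (intro mult_left_mono shift_minimal_norm_le Suc.prems) auto
  also have "\<dots> = norm (p\<^sup>2 - of_real (d\<^sup>2))"
    by (simp add: algebra_simps power2_eq_square flip: norm_mult)
  finally have "norm (p - of_real d) * norm p / (norm p)\<^sup>2 \<le> norm (p\<^sup>2 - of_real (d\<^sup>2)) / (norm p)\<^sup>2"
    by (rule divide_right_mono) simp
  then have "norm (p - of_real d) / norm p \<le> norm (p\<^sup>2 - of_real (d\<^sup>2)) / norm (p\<^sup>2)"
    using Suc.prems(2) by (simp add: norm_power) (simp add: power2_eq_square)
  also have "\<dots> \<le> 1 + (\<bar>d\<^sup>2\<bar> / norm (p\<^sup>2)) ^ 2 ^ j"
    by (intro Suc.IH shift_minimal_power2 Suc.prems) (use Suc.prems in auto)
  also have "(\<bar>d\<^sup>2\<bar> / norm (p\<^sup>2)) ^ 2 ^ j = (\<bar>d\<bar> / norm p) ^ 2 ^ Suc j"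
    by (simp add: norm_power power_mult power_divide)
  finally show ?case .
qed

lemma shift_minimal_norm_eq:
  assumes "shift_minimal p" "\<bar>d\<bar> < norm p"
  shows "norm (p + of_real d) = norm p"
proof (rule antisym)
  have p: "p \<noteq> 0" using assms(2) by auto
  have "(\<lambda>j. (\<bar>d\<bar> / norm p) ^ 2 ^ j) \<longlonglongrightarrow> 0"
  proof -
    have "(\<lambda>n. (\<bar>d\<bar> / norm p) ^ n) \<longlonglongrightarrow> 0"
      using assms(2) p by (intro LIMSEQ_power_zero) auto
    moreover have "strict_mono (\<lambda>j::nat. (2::nat) ^ j)" by (auto intro: strict_monoI)
    ultimately show ?thesis using LIMSEQ_subseq_LIMSEQ by (fastforce simp: o_def)
  qed
  then have "(\<lambda>j. 1 + (\<bar>d\<bar> / norm p) ^ 2 ^ j) \<longlonglongrightarrow> 1 + 0" by (intro tendsto_intros)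
  then have "norm (p - of_real (- d)) / norm p \<le> 1 + 0"
    using shift_minimal_diff_le[OF assms(1) p, of "- d"] by (intro LIMSEQ_le_const) auto
  then show "norm (p + of_real d) \<le> norm p" using p by (simp add: field_simps)
qed (rule shift_minimal_norm_le[OF assms(1)])

text \<open>
  A form of the Gelfand--Mazur theorem for fields with multiplicative norm. The norm
  \<open>F (s, t)\<close> of the left-hand side is continuous and coercive, so it has a minimum
  \<open>m\<close>; let \<open>q\<close> be a value of the left-hand side with norm \<open>m\<close>. By
  \<open>biquadratic_factorization\<close> every complex shift of \<open>q\<close> is a product of two
  values of the quadratic expression, so \<open>q\<close> is \<open>shift_minimal\<close>. If
  \<open>m > 0\<close>, then \<open>q + m / 2\<close> again has norm \<open>m\<close> and is
  \<open>shift_minimal\<close> for the same reason, hence so are \<open>q + m\<close>,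
  \<open>q + 3 * m / 2\<close>, and so on, although their norms are unbounded.
\<close>

lemma quadratic_over_reals:
  fixes x :: "'a::real_normed_field"
  shows "\<exists>s t :: real. (x - of_real s)\<^sup>2 + (of_real t)\<^sup>2 = 0"
proof -
  define F where "F = (\<lambda>(s, t). norm ((x - of_real s)\<^sup>2 + (of_real t)\<^sup>2))"
  have F_lower: "s\<^sup>2 + t\<^sup>2 - 2 * \<bar>s\<bar> * norm x - (norm x)\<^sup>2 \<le> F (s, t)" for s t
  proof -
    have eq: "(x - of_real s)\<^sup>2 + (of_real t)\<^sup>2 = of_real (s\<^sup>2 + t\<^sup>2) - (2 * of_real s * x - x\<^sup>2)"
      by (simp add: power2_eq_square algebra_simps)
    have "norm (of_real (s\<^sup>2 + t\<^sup>2) :: 'a) - norm (2 * of_real s * x - x\<^sup>2) \<le> F (s, t)"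
      unfolding F_def prod.case eq by (rule norm_triangle_ineq2)
    moreover have "norm (2 * of_real s * x - x\<^sup>2) \<le> 2 * \<bar>s\<bar> * norm x + (norm x)\<^sup>2"
      by (rule norm_triangle_le_diff) (simp add: norm_mult norm_power)
    moreover have "norm (of_real (s\<^sup>2 + t\<^sup>2) :: 'a) = s\<^sup>2 + t\<^sup>2" by (simp only: norm_of_real) simp
    ultimately show ?thesis by linarith
  qed
  have "\<exists>z0. \<forall>z. F z0 \<le> F z"
  proof -
    define a where "a = norm x"
    \<comment> \<open>Outside this box \<open>F\<close> is at least \<open>F (0, 0) = a\<^sup>2\<close>, so a minimum on the box is a global one.\<close>
    define B where "B = cbox (- (3 * a), - (3 * a)) (3 * a, 3 * a)"
    have "\<exists>z0\<in>B. \<forall>z\<in>B. F z0 \<le> F z"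
    proof (rule continuous_attains_inf)
      show "compact B" by (simp add: B_def)
      show "B \<noteq> {}" by (auto simp: B_def a_def cbox_Pair_eq)
      show "continuous_on B F" unfolding F_def case_prod_unfold by (intro continuous_intros)
    qed
    then obtain z0 where z0: "z0 \<in> B" "\<And>z. z \<in> B \<Longrightarrow> F z0 \<le> F z" by blast
    have "F z0 \<le> F (0, 0)" by (rule z0) (simp add: B_def a_def cbox_Pair_eq)
    then have le: "F z0 \<le> a\<^sup>2" by (simp add: F_def a_def norm_power)
    have "F z0 \<le> F z" if "z \<notin> B" for z
    proof -
      obtain s t where z: "z = (s, t)" by force
      have a: "a \<ge> 0" by (simp add: a_def)
      have "\<bar>s\<bar> > 3 * a \<or> \<bar>t\<bar> > 3 * a" using that by (auto simp: z B_def cbox_Pair_eq)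
      then have "2 * a\<^sup>2 \<le> (\<bar>s\<bar> - a)\<^sup>2 + \<bar>t\<bar>\<^sup>2 - a\<^sup>2"
      proof
        assume "\<bar>s\<bar> > 3 * a"
        then have "(2 * a)\<^sup>2 \<le> (\<bar>s\<bar> - a)\<^sup>2" using a by (intro power_mono) auto
        moreover have "0 \<le> \<bar>t\<bar>\<^sup>2" by simp
        moreover have "(2 * a)\<^sup>2 = 4 * a\<^sup>2" by (simp add: power2_eq_square)
        moreover have "0 \<le> a\<^sup>2" by simp
        ultimately show ?thesis by linarith
      next
        assume "\<bar>t\<bar> > 3 * a"
        then have "(3 * a)\<^sup>2 \<le> \<bar>t\<bar>\<^sup>2" using a by (intro power_mono) auto
        moreover have "0 \<le> (\<bar>s\<bar> - a)\<^sup>2" by simp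
        moreover have "(3 * a)\<^sup>2 = 9 * a\<^sup>2" by (simp add: power2_eq_square)
        moreover have "0 \<le> a\<^sup>2" by simp
        ultimately show ?thesis by linarith
      qed
      also have "(\<bar>s\<bar> - a)\<^sup>2 = s\<^sup>2 - 2 * \<bar>s\<bar> * a + a\<^sup>2"
        by (simp add: power2_diff)
      finally have "2 * a\<^sup>2 \<le> F z + a\<^sup>2"
        using F_lower[of s t] unfolding z a_def[symmetric] by simp
      then show ?thesis using le by linarith
    qed
    then show ?thesis using z0(2) by blast
  qed
  then obtain s t where min: "\<And>z. F (s, t) \<le> F z" by (metis surj_pair)
  define m where "m = F (s, t)"
  define q where "q = (x - of_real s)\<^sup>2 + (of_real t)\<^sup>2"
  have m_le: "m \<le> norm ((x - of_real a)\<^sup>2 + (of_real b)\<^sup>2)" for a b :: real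
    using min[of "(a, b)"] by (simp add: m_def F_def)
  have norm_q: "norm q = m" by (simp add: q_def m_def F_def)
  have minimal: "shift_minimal (q + of_real w)" if "norm (q + of_real w) = m" for w
    unfolding shift_minimal_def that
  proof (intro allI)
    fix u v
    obtain c d where cd: "((x - of_real s)\<^sup>2 + of_real (t\<^sup>2 + w + u))\<^sup>2 + (of_real v)\<^sup>2 =
        ((x - of_real s + of_real c)\<^sup>2 + (of_real d)\<^sup>2) * ((x - of_real s - of_real c)\<^sup>2 + (of_real d)\<^sup>2)"
      using biquadratic_factorization by blast
    have "(q + of_real w + of_real u)\<^sup>2 + (of_real v)\<^sup>2 =
        ((x - of_real (s - c))\<^sup>2 + (of_real d)\<^sup>2) * ((x - of_real (s + c))\<^sup>2 + (of_real d)\<^sup>2)"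
      using cd by (simp add: q_def algebra_simps)
    moreover have "m * m \<le> norm ((x - of_real (s - c))\<^sup>2 + (of_real d)\<^sup>2) * norm ((x - of_real (s + c))\<^sup>2 + (of_real d)\<^sup>2)"
      using m_le norm_q by (intro mult_mono m_le) auto
    ultimately show "m\<^sup>2 \<le> norm ((q + of_real w + of_real u)\<^sup>2 + (of_real v)\<^sup>2)"
      by (simp only: norm_mult power2_eq_square)
  qed
  have "m = 0"
  proof (rule ccontr)
    assume "m \<noteq> 0"
    then have m: "m > 0" using norm_q norm_ge_zero[of q] by linarith
    have const: "norm (q + of_real (real j * (m / 2))) = m" for j
    proof (induction j)
      case 0 then show ?case using norm_q by simp
    next
      case (Suc j)
      have "norm (q + of_real (real j * (m / 2)) + of_real (m / 2)) = m"
        using shift_minimal_norm_eq[OF minimal[OF Suc], of "m / 2"] Suc m by simp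
      moreover have "q + of_real (real j * (m / 2)) + of_real (m / 2) = q + of_real (real (Suc j) * (m / 2))"
        by (simp add: algebra_simps add_divide_distrib)
      ultimately show ?case by (simp only:)
    qed
    \<comment> \<open>Any number of steps above 4 would do: six steps shift \<open>q\<close> by \<open>3 * m\<close>, but two elements
      of norm \<open>m\<close> are at most \<open>2 * m\<close> apart.\<close>
    have "norm (of_real (real 6 * (m / 2)) :: 'a) \<le> norm (q + of_real (real 6 * (m / 2))) + norm q"
      using norm_triangle_ineq4[of "q + of_real (real 6 * (m / 2))" q] by simp
    then show False unfolding const norm_q norm_of_real using m by simp
  qed
  then show ?thesis using norm_q unfolding q_def by auto
qed

text \<open>
  Every scalar is a root of a real quadratic without distinct real roots, so the field is spanned over
  the reals by \<open>1\<close> and a square root of \<open>- 1\<close> if there is one, and by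
  \<open>1\<close> otherwise. The quadratic equation also bounds the two real coordinates of
  \<open>x\<close> by \<open>3 * norm x\<close>, so the ball lies in the continuous image of a compact
  box.
\<close>

lemma compact_cball_real_normed_field:
  fixes r :: real
  shows "compact (cball (0 :: 'a::real_normed_field) r)"
proof -
  have "\<exists>\<iota>::'a. \<forall>x. \<exists>s t. x = of_real s + of_real t * \<iota> \<and> (x - of_real s)\<^sup>2 + (of_real t)\<^sup>2 = 0"
  proof (cases "\<exists>\<iota>::'a. \<iota>\<^sup>2 = - 1")
    case True
    then obtain \<iota> :: 'a where i: "\<iota>\<^sup>2 = - 1" by blast
    have "\<exists>s t. x = of_real s + of_real t * \<iota> \<and> (x - of_real s)\<^sup>2 + (of_real t)\<^sup>2 = 0" for x :: 'a
    proof -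
      obtain s t where st: "(x - of_real s)\<^sup>2 + (of_real t)\<^sup>2 = 0" using quadratic_over_reals by blast
      then have "(x - of_real s)\<^sup>2 = (of_real t * \<iota>)\<^sup>2"
        by (simp add: power_mult_distrib i add_eq_0_iff2)
      then have "x - of_real s = of_real t * \<iota> \<or> x - of_real s = - (of_real t * \<iota>)"
        by (simp add: power2_eq_iff)
      then have "x = of_real s + of_real t * \<iota> \<or> x = of_real s + of_real (- t) * \<iota>"
        by (auto simp: algebra_simps)
      then show ?thesis using st by (metis of_real_minus power2_minus)
    qed
    then show ?thesis by blast
  next
    case False
    \<comment> \<open>Without a square root of \<open>- 1\<close> the field is one-dimensional; any value, here 0, may then
      stand for \<open>\<iota>\<close>.\<close>
    have "\<exists>s t. x = of_real s + of_real t * 0 \<and> (x - of_real s)\<^sup>2 + (of_real t)\<^sup>2 = 0" for x :: 'a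
    proof -
      obtain s t where st: "(x - of_real s)\<^sup>2 + (of_real t)\<^sup>2 = 0" using quadratic_over_reals by blast
      have "t = 0"
      proof (rule ccontr)
        assume "t \<noteq> 0"
        then have "((x - of_real s) / of_real t)\<^sup>2 = - 1"
          using st by (simp add: power_divide add_eq_0_iff2)
        then show False using False by blast
      qed
      with st show ?thesis by auto
    qed
    then show ?thesis by blast
  qed
  then obtain \<iota> :: 'a where i: "\<And>x. \<exists>s t. x = of_real s + of_real t * \<iota> \<and> (x - of_real s)\<^sup>2 + (of_real t)\<^sup>2 = 0"
    by blast
  define B where "B = cbox (- (3 * r), - (3 * r)) (3 * r, 3 * r)"
  define \<phi> where "\<phi> = (\<lambda>(s, t). of_real s + of_real t * \<iota>)"
  have "compact (\<phi> ` B)"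
    unfolding \<phi>_def case_prod_unfold B_def by (intro compact_continuous_image continuous_intros compact_cbox)
  moreover have "cball 0 r \<subseteq> \<phi> ` B"
  proof
    fix x :: 'a assume "x \<in> cball 0 r"
    then have x: "norm x \<le> r" by simp
    obtain s t where st: "x = of_real s + of_real t * \<iota>" "(x - of_real s)\<^sup>2 + (of_real t)\<^sup>2 = 0"
      using i by blast
    have "of_real (s\<^sup>2 + t\<^sup>2) = 2 * of_real s * x - x\<^sup>2"
      using st(2) by (simp add: power2_eq_square algebra_simps)
    then have "norm (of_real (s\<^sup>2 + t\<^sup>2) :: 'a) \<le> norm (2 * of_real s * x) + norm (x\<^sup>2)"
      by (metis norm_triangle_ineq4)
    then have *: "s\<^sup>2 + t\<^sup>2 \<le> 2 * \<bar>s\<bar> * norm x + (norm x)\<^sup>2"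
      unfolding norm_of_real by (simp add: norm_mult norm_power)
    have le: "(\<bar>s\<bar> - norm x)\<^sup>2 + t\<^sup>2 \<le> 2 * (norm x)\<^sup>2"
      using * by (simp add: power2_diff)
    have "2 * (norm x)\<^sup>2 \<le> (2 * norm x)\<^sup>2" by (simp add: power_mult_distrib)
    then have "(\<bar>s\<bar> - norm x)\<^sup>2 \<le> (2 * norm x)\<^sup>2" "\<bar>t\<bar>\<^sup>2 \<le> (2 * norm x)\<^sup>2"
      using le zero_le_power2[of t] zero_le_power2[of "\<bar>s\<bar> - norm x"] unfolding power2_abs by linarith+
    then have "\<bar>s\<bar> - norm x \<le> 2 * norm x" "\<bar>t\<bar> \<le> 2 * norm x"
      by (metis power2_le_imp_le norm_ge_zero mult_nonneg_nonneg zero_le_numeral)+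
    then have "(s, t) \<in> B" using x norm_ge_zero[of x] unfolding B_def cbox_Pair_eq by (auto simp: abs_le_iff)
    then show "x \<in> \<phi> ` B" using st(1) by (auto simp: \<phi>_def intro!: image_eqI[of _ _ "(s, t)"])
  qed
  ultimately show ?thesis
    using compact_Int_closed[of "\<phi> ` B" "cball 0 r"] by (simp add: Int_absorb1)
qed

section \<open>Power series spaces and the Montel property\<close>

lemma exponent_sequence_nonneg: "exponent_sequence \<beta> \<Longrightarrow> n \<ge> 1 \<Longrightarrow> 0 \<le> \<beta> n"
  by (simp add: exponent_sequence_def)

lemma exponent_sequence_mono: "exponent_sequence \<beta> \<Longrightarrow> 1 \<le> i \<Longrightarrow> i \<le> j \<Longrightarrow> \<beta> i \<le> \<beta> j"
  unfolding exponent_sequence_def by (meson atLeast_iff mono_onD order_trans)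

lemma Lambda_inf_summable:
  "x \<in> Lambda_inf \<beta> \<Longrightarrow> k \<ge> 1 \<Longrightarrow> (\<lambda>n. norm (x n) * exp (real k * \<beta> n)) summable_on {1..}"
  by (simp add: Lambda_inf_def)

lemma Lambda_inf_diff:
  fixes x y :: "nat \<Rightarrow> 'a::real_normed_field"
  assumes "x \<in> Lambda_inf \<beta>" "y \<in> Lambda_inf \<beta>"
  shows "(\<lambda>n. x n - y n) \<in> Lambda_inf \<beta>"
  using Lambda_inf_add[OF assms(1) Lambda_inf_scale[OF assms(2), of "- 1"]] by simp

lemma Lambda_norm_nonneg: "0 \<le> Lambda_norm \<beta> k x"
  unfolding Lambda_norm_def by (intro infsum_nonneg) auto

lemma Lambda_norm_coord_le:
  assumes "x \<in> Lambda_inf \<beta>" "k \<ge> 1" "n \<ge> 1"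
  shows "norm (x n) * exp (real k * \<beta> n) \<le> Lambda_norm \<beta> k x"
  using Lambda_norm_coord_sum_le[OF assms(1,2), of "{n}"] assms(3) by simp

lemma norm_coord_le_Lambda_norm:
  assumes "exponent_sequence \<beta>" "x \<in> Lambda_inf \<beta>" "k \<ge> 1" "n \<ge> 1"
  shows "norm (x n) \<le> Lambda_norm \<beta> k x"
proof -
  have "norm (x n) * 1 \<le> norm (x n) * exp (real k * \<beta> n)"
    using exponent_sequence_nonneg[OF assms(1,4)] by (intro mult_left_mono) auto
  also have "\<dots> \<le> Lambda_norm \<beta> k x" by (rule Lambda_norm_coord_le[OF assms(2-4)])
  finally show ?thesis by simp
qed

lemma Lambda_norm_triangle:
  assumes "x \<in> Lambda_inf \<beta>" "y \<in> Lambda_inf \<beta>" "k \<ge> 1"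
  shows "Lambda_norm \<beta> k (\<lambda>n. x n + y n) \<le> Lambda_norm \<beta> k x + Lambda_norm \<beta> k y"
  unfolding Lambda_norm_def
proof (subst infsum_add[symmetric])
  note s = Lambda_inf_summable[OF assms(1,3)] Lambda_inf_summable[OF assms(2,3)]
  show "(\<lambda>n. norm (x n) * exp (real k * \<beta> n)) summable_on {1..}"
       "(\<lambda>n. norm (y n) * exp (real k * \<beta> n)) summable_on {1..}" by (fact s)+
  show "(\<Sum>\<^sub>\<infinity>n\<in>{1..}. norm (x n + y n) * exp (real k * \<beta> n)) \<le>
      (\<Sum>\<^sub>\<infinity>n\<in>{1..}. norm (x n) * exp (real k * \<beta> n) + norm (y n) * exp (real k * \<beta> n))"
  proof (rule infsum_mono)
    show "norm (x n + y n) * exp (real k * \<beta> n) \<le>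
        norm (x n) * exp (real k * \<beta> n) + norm (y n) * exp (real k * \<beta> n)" for n
      by (metis distrib_right exp_ge_zero mult_right_mono norm_triangle_ineq)
  qed (use s Lambda_inf_summable[OF Lambda_inf_add[OF assms(1,2)] assms(3)] in \<open>auto intro: summable_on_add\<close>)
qed

lemma Lambda_norm_index_mono:
  assumes "exponent_sequence \<beta>" "x \<in> Lambda_inf \<beta>" "1 \<le> i" "i \<le> k"
  shows "Lambda_norm \<beta> i x \<le> Lambda_norm \<beta> k x"
  unfolding Lambda_norm_def
proof (rule infsum_mono)
  show "norm (x n) * exp (real i * \<beta> n) \<le> norm (x n) * exp (real k * \<beta> n)" if "n \<in> {1..}" for n
    using assms(4) exponent_sequence_nonneg[OF assms(1)] that by (simp add: mult_left_mono mult_right_mono)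
qed (rule Lambda_inf_summable; use assms in simp)+

text \<open>
  Membership and norm bounds are reduced to finite partial sums, so that a double series can be
  estimated by interchanging a finite sum with an infinite one.
\<close>

lemma Lambda_infI_finite_sums:
  assumes "x 0 = 0"
    and "\<And>k. k \<ge> 1 \<Longrightarrow> \<exists>B. \<forall>F. finite F \<and> F \<subseteq> {1..} \<longrightarrow> (\<Sum>n\<in>F. norm (x n) * exp (real k * \<beta> n)) \<le> B"
  shows "x \<in> Lambda_inf \<beta>"
  unfolding Lambda_inf_def
proof (intro CollectI conjI allI impI)
  fix k :: nat assume k: "k \<ge> 1"
  obtain B where B: "\<forall>F. finite F \<and> F \<subseteq> {1..} \<longrightarrow> (\<Sum>n\<in>F. norm (x n) * exp (real k * \<beta> n)) \<le> B"
    using assms(2)[OF k] by (rule exE)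
  show "(\<lambda>n. norm (x n) * exp (real k * \<beta> n)) summable_on {1..}"
  proof (rule nonneg_bdd_above_summable_on)
    show "bdd_above (sum (\<lambda>n. norm (x n) * exp (real k * \<beta> n)) ` {F. F \<subseteq> {1..} \<and> finite F})"
      by (rule bdd_aboveI2[where M = B]) (use B in blast)
  qed simp
qed fact

lemma Lambda_norm_le_finite_sums:
  assumes "x \<in> Lambda_inf \<beta>" "k \<ge> 1"
    and "\<And>F. finite F \<Longrightarrow> F \<subseteq> {1..} \<Longrightarrow> (\<Sum>n\<in>F. norm (x n) * exp (real k * \<beta> n)) \<le> B"
  shows "Lambda_norm \<beta> k x \<le> B"
  unfolding Lambda_norm_def using Lambda_inf_summable[OF assms(1,2)] assms(3)
  by (rule infsum_le_finite_sums)

text \<open>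
  The vectors on the left are the tails of the expansion of \<open>x\<close> in unit vectors. An
  operator bounded by \<open>Lambda_norm \<beta> k\<close> maps them to null sequences, which is how the
  convergence of operator series is obtained below.
\<close>

lemma Lambda_norm_head_zero_tendsto:
  fixes x :: "nat \<Rightarrow> 'a::real_normed_field"
  assumes "x \<in> Lambda_inf \<beta>" "k \<ge> 1"
  shows "(\<lambda>N. Lambda_norm \<beta> k (\<lambda>n. if n \<le> N then 0 else x n)) \<longlonglongrightarrow> 0"
proof -
  let ?g = "\<lambda>n. norm (x n) * exp (real k * \<beta> n)"
  note g = Lambda_inf_summable[OF assms]
  have g': "(\<lambda>j. ?g (Suc j)) summable_on UNIV"
    using g summable_on_reindex[of Suc UNIV ?g] by (simp add: o_def range_Suc_eq)
  have inf: "infsum ?g {1..} = (\<Sum>j. ?g (Suc j))"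
    using infsum_reindex[of Suc UNIV ?g] sums_unique[OF has_sum_imp_sums[OF has_sum_infsum[OF g']]]
    by (simp add: o_def range_Suc_eq)
  have eq: "Lambda_norm \<beta> k (\<lambda>n. if n \<le> N then 0 else x n) = infsum ?g {1..} - (\<Sum>j<N. ?g (Suc j))" for N
  proof -
    have "Lambda_norm \<beta> k (\<lambda>n. if n \<le> N then 0 else x n) = infsum ?g ({1..} - {1..N})"
      unfolding Lambda_norm_def by (rule infsum_cong_neutral) auto
    also have "\<dots> = infsum ?g {1..} - infsum ?g {1..N}"
      using infsum_Un_disjoint[of ?g "{1..} - {1..N}" "{1..N}"] summable_on_subset_banach[OF g, of "{1..} - {1..N}"]
      by (simp add: Un_absorb2 Int_commute)
    also have "infsum ?g {1..N} = (\<Sum>j<N. ?g (Suc j))"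
      by (simp add: sum.atLeast1_atMost_eq)
    finally show ?thesis .
  qed
  have "(\<lambda>N. infsum ?g {1..} - (\<Sum>j<N. ?g (Suc j))) \<longlonglongrightarrow> infsum ?g {1..} - infsum ?g {1..}"
    using summable_LIMSEQ[OF summable_on_imp_summable[OF g']] inf by (intro tendsto_intros) simp
  then show ?thesis by (simp add: eq)
qed

text \<open>
  Because of the triangle inequality, \<open>y\<close> in the ball has a whole ball around it whose
  radius is the smallest of the \<open>k\<close> distances that are left.
\<close>

lemma openin_seminorm_ball:
  fixes x :: "nat \<Rightarrow> 'a::real_normed_field"
  assumes "x \<in> Lambda_inf \<beta>" "k \<ge> 1"
  shows "openin (Lambda_topology \<beta>) (seminorm_ball (Lambda_inf \<beta>) (Lambda_norm \<beta>) x k \<epsilon>)"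
  unfolding openin_seminorm_topology
proof (intro conjI ballI)
  let ?B = "seminorm_ball (Lambda_inf \<beta>) (Lambda_norm \<beta>)"
  show "?B x k \<epsilon> \<subseteq> Lambda_inf \<beta>" by (auto simp: seminorm_ball_def)
  fix y assume y: "y \<in> ?B x k \<epsilon>"
  define \<delta> where "\<delta> = Min ((\<lambda>i. \<epsilon> - Lambda_norm \<beta> i (\<lambda>n. y n - x n)) ` {1..k})"
  have "\<delta> > 0" unfolding \<delta>_def using y assms(2) by (subst Min_gr_iff) (auto simp: seminorm_ball_def)
  moreover have "?B y k \<delta> \<subseteq> ?B x k \<epsilon>"
  proof
    fix z assume z: "z \<in> ?B y k \<delta>"
    have mem: "x \<in> Lambda_inf \<beta>" "y \<in> Lambda_inf \<beta>" "z \<in> Lambda_inf \<beta>"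
      using assms(1) y z by (auto simp: seminorm_ball_def)
    have "Lambda_norm \<beta> i (\<lambda>n. z n - x n) < \<epsilon>" if i: "i \<in> {1..k}" for i
    proof -
      have "Lambda_norm \<beta> i (\<lambda>n. z n - y n) < \<delta>" using z i by (auto simp: seminorm_ball_def)
      moreover have "\<delta> \<le> \<epsilon> - Lambda_norm \<beta> i (\<lambda>n. y n - x n)"
        unfolding \<delta>_def using i by (intro Min_le) auto
      moreover have "Lambda_norm \<beta> i (\<lambda>n. (z n - y n) + (y n - x n)) \<le>
          Lambda_norm \<beta> i (\<lambda>n. z n - y n) + Lambda_norm \<beta> i (\<lambda>n. y n - x n)"
        using i mem by (intro Lambda_norm_triangle Lambda_inf_diff) auto
      ultimately show ?thesis by simp
    qed
    then show "z \<in> ?B x k \<epsilon>" using mem by (auto simp: seminorm_ball_def)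
  qed
  ultimately show "\<exists>l\<ge>1. \<exists>\<delta>>0. ?B y l \<delta> \<subseteq> ?B x k \<epsilon>" using assms(2) by blast
qed

lemma limitin_LambdaI:
  assumes "y \<in> Lambda_inf \<beta>" "\<And>N. f N \<in> Lambda_inf \<beta>"
    and "\<And>k. k \<ge> 1 \<Longrightarrow> (\<lambda>N. Lambda_norm \<beta> k (\<lambda>n. f N n - y n)) \<longlonglongrightarrow> 0"
  shows "limitin (Lambda_topology \<beta>) f y sequentially"
  unfolding limitin_def topspace_seminorm_topology
proof (intro conjI allI impI)
  fix U assume "openin (Lambda_topology \<beta>) U \<and> y \<in> U"
  then obtain k \<epsilon> where k: "\<epsilon> > 0" "seminorm_ball (Lambda_inf \<beta>) (Lambda_norm \<beta>) y k \<epsilon> \<subseteq> U"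
    unfolding openin_seminorm_topology by blast
  have "\<forall>\<^sub>F N in sequentially. \<forall>i\<in>{1..k}. Lambda_norm \<beta> i (\<lambda>n. f N n - y n) < \<epsilon>"
    using k(1) by (intro eventually_ball_finite ballI order_tendstoD(2)[OF assms(3)]) auto
  then show "\<forall>\<^sub>F N in sequentially. f N \<in> U"
    by eventually_elim (use k(2) assms(2) in \<open>auto simp: seminorm_ball_def\<close>)
qed fact

lemma limitin_Lambda_coord:
  fixes f :: "nat \<Rightarrow> nat \<Rightarrow> 'a::real_normed_field"
  assumes "exponent_sequence \<beta>" "limitin (Lambda_topology \<beta>) f y sequentially" "n \<ge> 1"
  shows "(\<lambda>N. f N n) \<longlonglongrightarrow> y n"
proof (rule tendstoI)
  fix \<epsilon> :: real assume \<epsilon>: "\<epsilon> > 0"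
  let ?B = "seminorm_ball (Lambda_inf \<beta>) (Lambda_norm \<beta>) y 1 \<epsilon>"
  have y: "y \<in> Lambda_inf \<beta>" using assms(2) by (simp add: limitin_def)
  have "y \<in> ?B" using y \<epsilon> by (simp add: seminorm_ball_def Lambda_norm_def)
  then have "\<forall>\<^sub>F N in sequentially. f N \<in> ?B"
    using assms(2) openin_seminorm_ball[OF y, of 1] by (auto simp: limitin_def)
  then show "\<forall>\<^sub>F N in sequentially. dist (f N n) (y n) < \<epsilon>"
  proof eventually_elim
    case (elim N)
    then have "f N \<in> Lambda_inf \<beta>" "Lambda_norm \<beta> 1 (\<lambda>n. f N n - y n) < \<epsilon>"
      by (auto simp: seminorm_ball_def)
    then show ?case
      using norm_coord_le_Lambda_norm[OF assms(1) Lambda_inf_diff[OF _ y], of "f N" 1 n] assms(3)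
      by (simp add: dist_norm)
  qed
qed

text \<open>
  Uniqueness of limits is what allows the description operator in \<open>series_operator\<close> to be
  evaluated.
\<close>

lemma limitin_Lambda_unique:
  fixes f :: "nat \<Rightarrow> nat \<Rightarrow> 'a::real_normed_field"
  assumes "exponent_sequence \<beta>" "limitin (Lambda_topology \<beta>) f y sequentially"
    "limitin (Lambda_topology \<beta>) f z sequentially"
  shows "y = z"
proof
  fix n
  show "y n = z n"
  proof (cases "n \<ge> 1")
    case True
    then show ?thesis using LIMSEQ_unique[OF limitin_Lambda_coord[OF assms(1,2)] limitin_Lambda_coord[OF assms(1,3)]] by blast
  next
    case False
    then show ?thesis using assms(2,3) by (simp add: limitin_def Lambda_inf_def not_le)
  qed
qed

text \<open>
  The Montel property. In passing from \<open>Lambda_norm \<beta> k\<close> to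
  \<open>Lambda_norm \<beta> (k + 1)\<close> the weights gain the factor \<open>exp (\<beta> n)\<close>,
  which tends to infinity. Hence a bound on the larger norm makes the tails small in the smaller one,
  uniformly on the set, and finitely many coordinates remain. Each of them ranges over a bounded set of
  scalars, which is totally bounded because scalar balls are compact.
\<close>

lemma precompact_bounded:
  fixes S :: "(nat \<Rightarrow> 'a::real_normed_field) set"
  assumes \<beta>: "exponent_sequence \<beta>" and S: "S \<subseteq> Lambda_inf \<beta>"
    and bounded: "\<And>k. k \<ge> 1 \<Longrightarrow> \<exists>B. \<forall>y\<in>S. Lambda_norm \<beta> k y \<le> B"
  shows "precompact (Lambda_inf \<beta>) (Lambda_norm \<beta>) S"
  unfolding precompact_def
proof (intro conjI allI impI)
  fix k :: nat and \<epsilon> :: real assume k: "k \<ge> 1" and \<epsilon>: "\<epsilon> > 0"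
  obtain B0 where B0: "\<And>y. y \<in> S \<Longrightarrow> Lambda_norm \<beta> (k + 1) y \<le> B0"
    using bounded[of "k + 1"] by auto
  define B where "B = max B0 1"
  have B: "B > 0" "\<And>y. y \<in> S \<Longrightarrow> Lambda_norm \<beta> (k + 1) y \<le> B"
    using B0 by (auto simp: B_def le_max_iff_disj)
  \<comment> \<open>Weights \<open>exp (\<beta> n) \<ge> exp L\<close> bring the tail below \<open>\<epsilon> / 4\<close>.\<close>
  define L where "L = ln (4 * B / \<epsilon>)"
  have L: "exp (- L) * B = \<epsilon> / 4" using B(1) \<epsilon> by (simp add: L_def exp_minus field_simps)
  obtain N where N: "\<And>n. n \<ge> N \<Longrightarrow> L \<le> \<beta> n"
    using \<beta> unfolding exponent_sequence_def filterlim_at_top eventually_sequentially by blast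
  define W where "W = (\<Sum>n\<in>{1..N}. exp (real k * \<beta> n))"
  have W: "W \<ge> 0" unfolding W_def by (intro sum_nonneg) auto
  \<comment> \<open>Errors below \<open>\<delta>\<close> in the first \<open>N\<close> coordinates cost at most \<open>\<epsilon> / 4\<close>; \<open>W + 1\<close> avoids division by
    zero when \<open>N = 0\<close>.\<close>
  define \<delta> where "\<delta> = \<epsilon> / (4 * (W + 1))"
  have \<delta>: "\<delta> > 0" "\<delta> * W \<le> \<epsilon> / 4" using \<epsilon> W by (simp_all add: \<delta>_def field_simps)
  obtain D :: "'a set" where D: "finite D" "cball 0 B \<subseteq> (\<Union>d\<in>D. ball d \<delta>)"
    using compact_cball_real_normed_field[of B, where 'a = 'a] \<delta>(1)
    unfolding compact_eq_totally_bounded by blast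
  define A where "A = {a :: nat \<Rightarrow> 'a. \<forall>n. (n \<in> {1..N} \<longrightarrow> a n \<in> D) \<and> (n \<notin> {1..N} \<longrightarrow> a n = 0)}"
  have "finite A" unfolding A_def using D(1) by (intro finite_set_of_finite_funs) auto
  moreover have AL: "A \<subseteq> Lambda_inf \<beta>"
  proof
    fix a assume a: "a \<in> A"
    have "(\<lambda>n. norm (a n) * exp (real l * \<beta> n)) summable_on {1..}" for l
      by (rule summable_on_cong_neutral[where S = "{1..N}", THEN iffD1]) (use a in \<open>auto simp: A_def\<close>)
    then show "a \<in> Lambda_inf \<beta>" using a by (simp add: Lambda_inf_def A_def)
  qed
  moreover have "S \<subseteq> (\<Union>a\<in>A. seminorm_ball (Lambda_inf \<beta>) (Lambda_norm \<beta>) a k \<epsilon>)"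
  proof
    fix y assume y: "y \<in> S"
    then have yL: "y \<in> Lambda_inf \<beta>" using S by blast
    have "\<exists>d\<in>D. norm (y n - d) < \<delta>" if "n \<in> {1..N}" for n
    proof -
      have "norm (y n) \<le> B"
        using norm_coord_le_Lambda_norm[OF \<beta> yL, of "k + 1" n] B(2)[OF y] that by simp
      then have "y n \<in> cball 0 B" by simp
      then have "y n \<in> (\<Union>d\<in>D. ball d \<delta>)" using D(2) by blast
      then show ?thesis by (auto simp: dist_norm norm_minus_commute)
    qed
    then obtain d where d: "\<And>n. n \<in> {1..N} \<Longrightarrow> d n \<in> D \<and> norm (y n - d n) < \<delta>" by metis
    define a where "a = (\<lambda>n. if n \<in> {1..N} then d n else 0)"
    have a: "a \<in> A" using d by (auto simp: A_def a_def)
    let ?h = "\<lambda>n. if n \<in> {1..N} then \<delta> * exp (real k * \<beta> n) else 0"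
    let ?t = "\<lambda>n. exp (- L) * (norm (y n) * exp (real (k + 1) * \<beta> n))"
    have diff: "(\<lambda>n. y n - a n) \<in> Lambda_inf \<beta>" using a AL yL by (intro Lambda_inf_diff) auto
    have h: "(?h has_sum (\<delta> * W)) {1..}"
    proof -
      have "((\<lambda>n. \<delta> * exp (real k * \<beta> n)) has_sum (\<delta> * W)) {1..N}"
        by (rule has_sum_finiteI) (simp_all add: W_def sum_distrib_left)
      then show ?thesis by (rule has_sum_cong_neutral[THEN iffD1, rotated -1]) auto
    qed
    have t: "(?t has_sum (exp (- L) * Lambda_norm \<beta> (k + 1) y)) {1..}"
      unfolding Lambda_norm_def by (intro has_sum_cmult_right has_sum_infsum Lambda_inf_summable yL) simp
    have "norm (y n - a n) * exp (real k * \<beta> n) \<le> ?h n + ?t n" if n: "n \<in> {1..}" for n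
    proof (cases "n \<le> N")
      case True
      then have "norm (y n - a n) * exp (real k * \<beta> n) \<le> \<delta> * exp (real k * \<beta> n)"
        using d[of n] n by (intro mult_right_mono) (auto simp: a_def)
      then show ?thesis using True n by (auto intro!: add_increasing2)
    next
      case False
      then have "real k * \<beta> n \<le> - L + real (k + 1) * \<beta> n" using N[of n] by (simp add: algebra_simps)
      then have "exp (real k * \<beta> n) \<le> exp (- L) * exp (real (k + 1) * \<beta> n)"
        by (simp only: exp_add[symmetric] exp_le_cancel_iff)
      then have "norm (y n) * exp (real k * \<beta> n) \<le> norm (y n) * (exp (- L) * exp (real (k + 1) * \<beta> n))"
        by (rule mult_left_mono) simp
      then show ?thesis using False by (simp add: a_def mult_ac)
    qed
    then have "Lambda_norm \<beta> k (\<lambda>n. y n - a n) \<le> \<delta> * W + exp (- L) * Lambda_norm \<beta> (k + 1) y"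
      unfolding Lambda_norm_def[of \<beta> k]
      by (intro has_sum_mono[OF has_sum_infsum[OF Lambda_inf_summable[OF diff k]] has_sum_add[OF h t]])
    also have "\<dots> \<le> \<epsilon> / 4 + exp (- L) * B" using \<delta>(2) B(2)[OF y] by (intro add_mono mult_left_mono) auto
    also have "\<dots> < \<epsilon>" using L \<epsilon> by simp
    finally have "Lambda_norm \<beta> i (\<lambda>n. y n - a n) < \<epsilon>" if "i \<in> {1..k}" for i
      using Lambda_norm_index_mono[OF \<beta> diff, of i k] that by simp
    then have "y \<in> seminorm_ball (Lambda_inf \<beta>) (Lambda_norm \<beta>) a k \<epsilon>"
      using yL unfolding seminorm_ball_def by blast
    with a show "y \<in> (\<Union>a\<in>A. seminorm_ball (Lambda_inf \<beta>) (Lambda_norm \<beta>) a k \<epsilon>)" by blast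
  qed
  ultimately show "\<exists>A. finite A \<and> A \<subseteq> Lambda_inf \<beta> \<and>
      S \<subseteq> (\<Union>a\<in>A. seminorm_ball (Lambda_inf \<beta>) (Lambda_norm \<beta>) a k \<epsilon>)" by blast
qed (fact S)

section \<open>Operators with bounded columns\<close>

text \<open>
  \<open>c n\<close> is the image of the \<open>n\<close>-th unit vector, whose norm with index
  \<open>M\<close> is \<open>exp (M * \<alpha> n)\<close>. The point is the order of the quantifiers:
  one \<open>M\<close> serves for all seminorms of the target, which expresses boundedness on a
  neighbourhood of zero rather than mere continuity.
\<close>

definition bounded_columns ::
    "(nat \<Rightarrow> real) \<Rightarrow> nat \<Rightarrow> (nat \<Rightarrow> real) \<Rightarrow> (nat \<Rightarrow> nat \<Rightarrow> 'a::real_normed_vector) \<Rightarrow> bool"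
  where "bounded_columns \<alpha> M \<beta> c \<longleftrightarrow> (\<forall>n\<ge>1. c n \<in> Lambda_inf \<beta>) \<and>
    (\<forall>k\<ge>1. \<exists>C\<ge>0. \<forall>n\<ge>1. Lambda_norm \<beta> k (c n) \<le> C * exp (real M * \<alpha> n))"

definition column_sum :: "(nat \<Rightarrow> nat \<Rightarrow> 'a::real_normed_field) \<Rightarrow> (nat \<Rightarrow> 'a) \<Rightarrow> nat \<Rightarrow> 'a"
  where "column_sum c x j = (\<Sum>\<^sub>\<infinity>n\<in>{1..}. x n * c n j)"

lemma has_sum_finite_sum:
  fixes g :: "'j \<Rightarrow> 'n \<Rightarrow> 'b::topological_comm_monoid_add"
  assumes "finite F" "\<And>j. j \<in> F \<Longrightarrow> (g j has_sum S j) A"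
  shows "((\<lambda>n. \<Sum>j\<in>F. g j n) has_sum (\<Sum>j\<in>F. S j)) A"
  using assms by (induction F) (auto intro: has_sum_add)

context
  fixes \<alpha> \<beta> :: "nat \<Rightarrow> real" and M :: nat and c :: "nat \<Rightarrow> nat \<Rightarrow> 'a::{real_normed_field, banach}"
  assumes \<beta>: "exponent_sequence \<beta>" and M: "M \<ge> 1" and c: "bounded_columns \<alpha> M \<beta> c"
begin

lemma column_mem: "n \<ge> 1 \<Longrightarrow> c n \<in> Lambda_inf \<beta>"
  using c by (simp add: bounded_columns_def)

lemma column_bound:
  assumes "k \<ge> 1"
  obtains C where "C \<ge> 0" "\<And>n. n \<ge> 1 \<Longrightarrow> Lambda_norm \<beta> k (c n) \<le> C * exp (real M * \<alpha> n)"
  using c assms unfolding bounded_columns_def by meson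

lemma abs_summable_column_entries:
  assumes x: "x \<in> Lambda_inf \<alpha>" and j: "j \<ge> 1"
  shows "(\<lambda>n. norm (x n * c n j)) summable_on {1..}"
proof -
  obtain C where C: "\<And>n. n \<ge> 1 \<Longrightarrow> Lambda_norm \<beta> 1 (c n) \<le> C * exp (real M * \<alpha> n)"
    using column_bound[of 1] by auto
  show ?thesis
  proof (rule Infinite_Sum.abs_summable_on_comparison_test')
    show "(\<lambda>n. C * (norm (x n) * exp (real M * \<alpha> n))) summable_on {1..}"
      by (intro summable_on_cmult_right Lambda_inf_summable x M)
    fix n :: nat assume n: "n \<in> {1..}"
    have "norm (c n j) \<le> C * exp (real M * \<alpha> n)"
      using norm_coord_le_Lambda_norm[OF \<beta> column_mem, of n 1 j] C[of n] n j by simp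
    then have "norm (x n) * norm (c n j) \<le> norm (x n) * (C * exp (real M * \<alpha> n))"
      by (rule mult_left_mono) simp
    then show "norm (x n * c n j) \<le> C * (norm (x n) * exp (real M * \<alpha> n))"
      by (simp add: norm_mult mult_ac)
  qed
qed

lemma column_zero: "n \<ge> 1 \<Longrightarrow> c n 0 = 0"
  using column_mem by (simp add: Lambda_inf_def)

lemma column_sum_zero: "column_sum c x 0 = 0"
  unfolding column_sum_def by (rule infsum_0) (simp add: column_zero)

text \<open>
  The norm of \<open>\<Sum>n. x n * c n\<close> is at most
  \<open>\<Sum>n. norm (x n) * Lambda_norm \<beta> k (c n)\<close>. Only finitely many coordinates
  \<open>j\<close> are summed, so the interchange of the sums over \<open>j\<close> and \<open>n\<close>
  needs no summability on the product.
\<close>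

lemma column_sum_finite_bound:
  assumes x: "x \<in> Lambda_inf \<alpha>" and k: "k \<ge> 1"
    and C: "\<And>n. n \<ge> 1 \<Longrightarrow> Lambda_norm \<beta> k (c n) \<le> C * exp (real M * \<alpha> n)"
    and F: "finite F" "F \<subseteq> {1..}"
  shows "(\<Sum>j\<in>F. norm (column_sum c x j) * exp (real k * \<beta> j)) \<le> C * Lambda_norm \<alpha> M x"
proof -
  let ?g = "\<lambda>j n. norm (x n * c n j) * exp (real k * \<beta> j)"
  have g: "?g j summable_on {1..}" if "j \<in> F" for j
    using abs_summable_column_entries[OF x, of j] that F by (intro summable_on_cmult_left) auto
  have sum_g: "((\<lambda>n. \<Sum>j\<in>F. ?g j n) has_sum (\<Sum>j\<in>F. infsum (?g j) {1..})) {1..}"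
    using F(1) g by (intro has_sum_finite_sum has_sum_infsum)
  have "(\<Sum>j\<in>F. norm (column_sum c x j) * exp (real k * \<beta> j)) \<le> (\<Sum>j\<in>F. \<Sum>\<^sub>\<infinity>n\<in>{1..}. ?g j n)"
  proof (rule sum_mono)
    fix j assume j: "j \<in> F"
    have "norm (column_sum c x j) \<le> (\<Sum>\<^sub>\<infinity>n\<in>{1..}. norm (x n * c n j))"
      unfolding column_sum_def using abs_summable_column_entries[OF x, of j] j F
      by (intro norm_infsum_bound) auto
    then show "norm (column_sum c x j) * exp (real k * \<beta> j) \<le> (\<Sum>\<^sub>\<infinity>n\<in>{1..}. ?g j n)"
      unfolding infsum_cmult_left' by (rule mult_right_mono) simp
  qed
  also have "\<dots> = (\<Sum>\<^sub>\<infinity>n\<in>{1..}. \<Sum>j\<in>F. ?g j n)"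
    by (rule infsumI[OF sum_g, symmetric])
  also have "\<dots> \<le> (\<Sum>\<^sub>\<infinity>n\<in>{1..}. C * (norm (x n) * exp (real M * \<alpha> n)))"
  proof (rule infsum_mono)
    show "(\<lambda>n. \<Sum>j\<in>F. ?g j n) summable_on {1..}" by (rule has_sum_imp_summable[OF sum_g])
    show "(\<lambda>n. C * (norm (x n) * exp (real M * \<alpha> n))) summable_on {1..}"
      by (intro summable_on_cmult_right Lambda_inf_summable x M)
    fix n :: nat assume n: "n \<in> {1..}"
    have "(\<Sum>j\<in>F. ?g j n) = norm (x n) * (\<Sum>j\<in>F. norm (c n j) * exp (real k * \<beta> j))"
      by (simp add: norm_mult sum_distrib_left mult_ac)
    also have "\<dots> \<le> norm (x n) * Lambda_norm \<beta> k (c n)"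
      using n F k by (intro mult_left_mono Lambda_norm_coord_sum_le column_mem) auto
    also have "\<dots> \<le> norm (x n) * (C * exp (real M * \<alpha> n))"
      using n by (intro mult_left_mono C) auto
    finally show "(\<Sum>j\<in>F. ?g j n) \<le> C * (norm (x n) * exp (real M * \<alpha> n))" by (simp add: mult_ac)
  qed
  also have "\<dots> = C * Lambda_norm \<alpha> M x"
    unfolding Lambda_norm_def by (rule infsum_cmult_right')
  finally show ?thesis .
qed

lemma column_sum_mem:
  assumes x: "x \<in> Lambda_inf \<alpha>"
  shows "column_sum c x \<in> Lambda_inf \<beta>"
proof (rule Lambda_infI_finite_sums[where x = "column_sum c x", OF column_sum_zero])
  fix k :: nat assume k: "k \<ge> 1"
  obtain C where C: "C \<ge> 0" "\<And>n. n \<ge> 1 \<Longrightarrow> Lambda_norm \<beta> k (c n) \<le> C * exp (real M * \<alpha> n)"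
    using column_bound[OF k] by blast
  have "\<forall>F. finite F \<and> F \<subseteq> {1..} \<longrightarrow>
      (\<Sum>j\<in>F. norm (column_sum c x j) * exp (real k * \<beta> j)) \<le> C * Lambda_norm \<alpha> M x"
    using column_sum_finite_bound[OF x k C(2)] by blast
  then show "\<exists>B. \<forall>F. finite F \<and> F \<subseteq> {1..} \<longrightarrow>
      (\<Sum>j\<in>F. norm (column_sum c x j) * exp (real k * \<beta> j)) \<le> B" by (rule exI)
qed

lemma column_sum_bound:
  assumes "k \<ge> 1"
  obtains C where "C \<ge> 0" "\<And>x. x \<in> Lambda_inf \<alpha> \<Longrightarrow> Lambda_norm \<beta> k (column_sum c x) \<le> C * Lambda_norm \<alpha> M x"
proof -
  obtain C where C: "C \<ge> 0" "\<And>n. n \<ge> 1 \<Longrightarrow> Lambda_norm \<beta> k (c n) \<le> C * exp (real M * \<alpha> n)"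
    using column_bound[OF assms] by blast
  have "Lambda_norm \<beta> k (column_sum c x) \<le> C * Lambda_norm \<alpha> M x" if "x \<in> Lambda_inf \<alpha>" for x
    using column_sum_finite_bound[OF that assms C(2)]
    by (intro Lambda_norm_le_finite_sums column_sum_mem that assms) auto
  with C(1) show thesis by (rule that)
qed

lemma summable_column_entries:
  assumes "x \<in> Lambda_inf \<alpha>"
  shows "(\<lambda>n. x n * c n j) summable_on {1..}"
proof (cases "j = 0")
  case True
  have "(\<lambda>n. x n * c n j) summable_on {1..} \<longleftrightarrow> (\<lambda>n. 0 :: 'a) summable_on {1::nat..}"
    by (rule summable_on_cong) (simp add: column_zero True)
  then show ?thesis by simp
next
  case False
  then show ?thesis by (intro Infinite_Sum.abs_summable_summable[OF abs_summable_column_entries] assms) simp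
qed

lemma column_sum_add:
  assumes "x \<in> Lambda_inf \<alpha>" "y \<in> Lambda_inf \<alpha>"
  shows "column_sum c (\<lambda>n. x n + y n) = (\<lambda>j. column_sum c x j + column_sum c y j)"
  unfolding column_sum_def distrib_right
  by (intro ext infsum_add summable_column_entries assms)

lemma column_sum_scale: "column_sum c (\<lambda>n. a * x n) = (\<lambda>j. a * column_sum c x j)"
  unfolding column_sum_def by (simp add: mult.assoc infsum_cmult_right')

text \<open>
  The difference between the series and its \<open>N\<close>-th partial sum is the operator applied to
  the tail of \<open>x\<close>, and the operator is bounded with respect to
  \<open>Lambda_norm \<alpha> M\<close>, in which the tails tend to zero.
\<close>

lemma column_series_converges:
  assumes x: "x \<in> Lambda_inf \<alpha>"
  shows "series_converges_to (Lambda_topology \<beta>) c x (column_sum c x)"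
  unfolding series_converges_to_def
proof (rule limitin_LambdaI)
  show "column_sum c x \<in> Lambda_inf \<beta>" by (rule column_sum_mem[OF x])
  show partial: "(\<lambda>j. \<Sum>n = 1..N. x n * c n j) \<in> Lambda_inf \<beta>" for N
  proof (induction N)
    case 0 then show ?case by (simp add: Lambda_inf_zero)
  next
    case (Suc N)
    then show ?case using Lambda_inf_add[OF Suc Lambda_inf_scale[OF column_mem[of "Suc N"], of "x (Suc N)"]] by simp
  qed
  fix k :: nat assume k: "k \<ge> 1"
  obtain C where C: "\<And>x. x \<in> Lambda_inf \<alpha> \<Longrightarrow> Lambda_norm \<beta> k (column_sum c x) \<le> C * Lambda_norm \<alpha> M x"
    using column_sum_bound[OF k] by blast
  define tail where "tail = (\<lambda>N n. if n \<le> N then 0 else x n)"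
  have tail: "tail N \<in> Lambda_inf \<alpha>" for N
  proof -
    have "(\<lambda>n. norm (tail N n) * exp (real l * \<alpha> n)) summable_on {1..}" if "l \<ge> 1" for l
      by (rule summable_on_comparison_test[OF Lambda_inf_summable[OF x that]]) (auto simp: tail_def)
    then show ?thesis using x by (simp add: Lambda_inf_def tail_def)
  qed
  have eq: "column_sum c (tail N) j = - ((\<Sum>n = 1..N. x n * c n j) - column_sum c x j)" for N j
  proof -
    have "column_sum c (tail N) j = infsum (\<lambda>n. x n * c n j) ({1..} - {1..N})"
      unfolding column_sum_def by (rule infsum_cong_neutral) (auto simp: tail_def)
    also have "\<dots> = column_sum c x j - (\<Sum>n = 1..N. x n * c n j)"
      using infsum_Un_disjoint[of "\<lambda>n. x n * c n j" "{1..} - {1..N}" "{1..N}"]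
        summable_on_subset_banach[OF summable_column_entries[OF x], of "{1..} - {1..N}"]
      by (simp add: Un_absorb2 Int_commute column_sum_def)
    finally show ?thesis by simp
  qed
  have le: "Lambda_norm \<beta> k (\<lambda>j. (\<Sum>n = 1..N. x n * c n j) - column_sum c x j) \<le> C * Lambda_norm \<alpha> M (tail N)" for N
  proof -
    have "Lambda_norm \<beta> k (\<lambda>j. (\<Sum>n = 1..N. x n * c n j) - column_sum c x j) = Lambda_norm \<beta> k (column_sum c (tail N))"
      unfolding Lambda_norm_def eq norm_minus_cancel ..
    then show ?thesis using C[OF tail] by simp
  qed
  have "(\<lambda>N. C * Lambda_norm \<alpha> M (tail N)) \<longlonglongrightarrow> C * 0"
    unfolding tail_def by (intro tendsto_intros Lambda_norm_head_zero_tendsto x M)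
  then have "(\<lambda>N. C * Lambda_norm \<alpha> M (tail N)) \<longlonglongrightarrow> 0" by simp
  then show "(\<lambda>N. Lambda_norm \<beta> k (\<lambda>j. (\<Sum>n = 1..N. x n * c n j) - column_sum c x j)) \<longlonglongrightarrow> 0"
    by (rule tendsto_sandwich[OF _ _ tendsto_const, rotated -1])
       (intro always_eventually allI le Lambda_norm_nonneg)+
qed

lemma series_well_defined_bounded_columns:
  "series_well_defined (Lambda_inf \<alpha>) (Lambda_topology \<beta>) c"
  unfolding series_well_defined_def topspace_seminorm_topology
proof (intro conjI allI ballI impI)
  show "c n \<in> Lambda_inf \<beta>" if "1 \<le> n" for n by (rule column_mem[OF that])
  show "\<exists>y. series_converges_to (Lambda_topology \<beta>) c x y" if "x \<in> Lambda_inf \<alpha>" for x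
    by (rule exI, rule column_series_converges[OF that])
qed

lemma series_operator_eq_column_sum:
  assumes "x \<in> Lambda_inf \<alpha>"
  shows "series_operator (Lambda_topology \<beta>) c x = column_sum c x"
  unfolding series_operator_def
proof (rule the_equality)
  show "series_converges_to (Lambda_topology \<beta>) c x (column_sum c x)" by (rule column_series_converges[OF assms])
  fix y assume "series_converges_to (Lambda_topology \<beta>) c x y"
  from limitin_Lambda_unique[OF \<beta> this[unfolded series_converges_to_def]
      column_series_converges[OF assms, unfolded series_converges_to_def]]
  show "y = column_sum c x" .
qed

end

text \<open>
  The unit ball of one seminorm of the domain is mapped to a set bounded in all seminorms of the target,
  and such sets are precompact by \<open>precompact_bounded\<close>.
\<close>

lemma compact_operator_seminorm_bounded:
  fixes T :: "(nat \<Rightarrow> 'a::real_normed_field) \<Rightarrow> nat \<Rightarrow> 'a"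
  assumes \<beta>: "exponent_sequence \<beta>" and M: "M \<ge> 1"
    and mem: "\<And>x. x \<in> Lambda_inf \<alpha> \<Longrightarrow> T x \<in> Lambda_inf \<beta>"
    and add: "\<And>x y. x \<in> Lambda_inf \<alpha> \<Longrightarrow> y \<in> Lambda_inf \<alpha> \<Longrightarrow> T (\<lambda>n. x n + y n) = (\<lambda>n. T x n + T y n)"
    and scale: "\<And>a x. x \<in> Lambda_inf \<alpha> \<Longrightarrow> T (\<lambda>n. a * x n) = (\<lambda>n. a * T x n)"
    and bound: "\<And>k. k \<ge> 1 \<Longrightarrow> \<exists>C\<ge>0. \<forall>x\<in>Lambda_inf \<alpha>. Lambda_norm \<beta> k (T x) \<le> C * Lambda_norm \<alpha> M x"
  shows "compact_operator (Lambda_inf \<alpha>) (Lambda_norm \<alpha>) (Lambda_inf \<beta>) (Lambda_norm \<beta>) T"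
  unfolding compact_operator_def
proof (intro conjI ballI allI)
  let ?U = "seminorm_ball (Lambda_inf \<alpha>) (Lambda_norm \<alpha>) (\<lambda>_. 0 :: 'a) M 1"
  have U: "x \<in> Lambda_inf \<alpha>" "Lambda_norm \<alpha> M x < 1" if "x \<in> ?U" for x
    using that M by (auto simp: seminorm_ball_def)
  have "openin (Lambda_topology \<alpha>) ?U" by (rule openin_seminorm_ball[OF Lambda_inf_zero M])
  moreover have "(\<lambda>_. 0) \<in> ?U" by (simp add: seminorm_ball_def Lambda_inf_zero Lambda_norm_def)
  moreover have "precompact (Lambda_inf \<beta>) (Lambda_norm \<beta>) (T ` ?U)"
  proof (rule precompact_bounded[OF \<beta>])
    show "T ` ?U \<subseteq> Lambda_inf \<beta>" using U(1) mem by blast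
    fix k :: nat assume "k \<ge> 1"
    then obtain C where C: "C \<ge> 0" "\<And>x. x \<in> Lambda_inf \<alpha> \<Longrightarrow> Lambda_norm \<beta> k (T x) \<le> C * Lambda_norm \<alpha> M x"
      using bound by blast
    have "Lambda_norm \<beta> k (T x) \<le> C" if "x \<in> ?U" for x
      using C(2)[OF U(1)[OF that]] mult_left_mono[OF less_imp_le[OF U(2)[OF that]] C(1)] by simp
    then show "\<exists>B. \<forall>y\<in>T ` ?U. Lambda_norm \<beta> k y \<le> B" by blast
  qed
  ultimately show "\<exists>U. openin (Lambda_topology \<alpha>) U \<and> (\<lambda>_. 0) \<in> U \<and>
      precompact (Lambda_inf \<beta>) (Lambda_norm \<beta>) (T ` U)" by blast
qed (fact mem add scale)+

section \<open>Columns of Toeplitz matrices\<close>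

lemma bounded_columnsI:
  assumes zero: "\<And>n. n \<ge> 1 \<Longrightarrow> c n 0 = 0"
    and bound: "\<And>k. k \<ge> 1 \<Longrightarrow> \<exists>C\<ge>0. \<forall>n\<ge>1. \<forall>F. finite F \<and> F \<subseteq> {1..} \<longrightarrow>
      (\<Sum>j\<in>F. norm (c n j) * exp (real k * \<beta> j)) \<le> C * exp (real M * \<alpha> n)"
  shows "bounded_columns \<alpha> M \<beta> c"
proof -
  have mem: "c n \<in> Lambda_inf \<beta>" if n: "n \<ge> 1" for n
  proof (rule Lambda_infI_finite_sums[where x = "c n", OF zero[OF n]])
    fix k :: nat assume k: "k \<ge> 1"
    obtain C where "\<forall>n\<ge>1. \<forall>F. finite F \<and> F \<subseteq> {1..} \<longrightarrow>
        (\<Sum>j\<in>F. norm (c n j) * exp (real k * \<beta> j)) \<le> C * exp (real M * \<alpha> n)"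
      using bound[OF k] by (elim exE conjE)
    from this[rule_format, OF n]
    have "\<forall>F. finite F \<and> F \<subseteq> {1..} \<longrightarrow>
        (\<Sum>j\<in>F. norm (c n j) * exp (real k * \<beta> j)) \<le> C * exp (real M * \<alpha> n)" by blast
    then show "\<exists>B. \<forall>F. finite F \<and> F \<subseteq> {1..} \<longrightarrow> (\<Sum>j\<in>F. norm (c n j) * exp (real k * \<beta> j)) \<le> B"
      by (rule exI)
  qed
  moreover have "\<exists>C\<ge>0. \<forall>n\<ge>1. Lambda_norm \<beta> k (c n) \<le> C * exp (real M * \<alpha> n)" if k: "k \<ge> 1" for k
  proof -
    obtain C where C: "C \<ge> 0" "\<forall>n\<ge>1. \<forall>F. finite F \<and> F \<subseteq> {1..} \<longrightarrow>
        (\<Sum>j\<in>F. norm (c n j) * exp (real k * \<beta> j)) \<le> C * exp (real M * \<alpha> n)"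
      using bound[OF k] by (elim exE conjE)
    have "Lambda_norm \<beta> k (c n) \<le> C * exp (real M * \<alpha> n)" if "n \<ge> 1" for n
      by (rule Lambda_norm_le_finite_sums[OF mem[OF that] k]) (use C(2) that in blast)
    with C(1) show ?thesis by blast
  qed
  ultimately show ?thesis unfolding bounded_columns_def by blast
qed

lemma bounded_columns_mono:
  assumes \<alpha>: "exponent_sequence \<alpha>" and c: "bounded_columns \<alpha> M \<beta> c" and le: "M \<le> M'"
  shows "bounded_columns \<alpha> M' \<beta> c"
  unfolding bounded_columns_def
proof (intro conjI allI impI)
  show "c n \<in> Lambda_inf \<beta>" if "1 \<le> n" for n using c that by (simp add: bounded_columns_def)
  fix k :: nat assume "1 \<le> k"
  then obtain C where C: "C \<ge> 0" "\<And>n. n \<ge> 1 \<Longrightarrow> Lambda_norm \<beta> k (c n) \<le> C * exp (real M * \<alpha> n)"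
    using c unfolding bounded_columns_def by meson
  have "Lambda_norm \<beta> k (c n) \<le> C * exp (real M' * \<alpha> n)" if n: "n \<ge> 1" for n
  proof -
    have "exp (real M * \<alpha> n) \<le> exp (real M' * \<alpha> n)"
      using le exponent_sequence_nonneg[OF \<alpha> n] by (simp add: mult_right_mono)
    then show ?thesis using C(2)[OF n] mult_left_mono[OF _ C(1)] by (meson order_trans)
  qed
  with C(1) show "\<exists>C\<ge>0. \<forall>n\<ge>1. Lambda_norm \<beta> k (c n) \<le> C * exp (real M' * \<alpha> n)" by blast
qed

text \<open>
  The index \<open>n + i - 1\<close> is at most twice the larger of \<open>n\<close> and
  \<open>i\<close>. It is the position of the \<open>i\<close>-th symbol coefficient in the
  \<open>n\<close>-th column.
\<close>

lemma stable_doubling: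
  assumes \<beta>: "exponent_sequence \<beta>" and "stable \<beta>"
  obtains d :: nat where "d \<ge> 1" "\<And>i n. i \<ge> 1 \<Longrightarrow> n \<ge> 1 \<Longrightarrow> \<beta> (n + i - 1) \<le> real d * (\<beta> n + \<beta> i)"
proof -
  obtain A where A: "\<And>n. n \<ge> 1 \<Longrightarrow> \<beta> (2 * n) \<le> A * \<beta> n" using assms(2) unfolding stable_def by blast
  define d where "d = max 1 (nat \<lceil>A\<rceil>)"
  have "A \<le> real d" unfolding d_def by linarith
  have "\<beta> (n + i - 1) \<le> real d * (\<beta> n + \<beta> i)" if "i \<ge> 1" "n \<ge> 1" for i n
  proof -
    let ?m = "max n i"
    have m: "?m \<ge> 1" using that by simp
    have "\<beta> (n + i - 1) \<le> \<beta> (2 * ?m)" using that by (intro exponent_sequence_mono[OF \<beta>]) auto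
    also have "\<dots> \<le> A * \<beta> ?m" by (rule A[OF m])
    also have "\<dots> \<le> real d * \<beta> ?m"
      using \<open>A \<le> real d\<close> exponent_sequence_nonneg[OF \<beta> m] by (rule mult_right_mono)
    also have "\<dots> \<le> real d * (\<beta> n + \<beta> i)"
      using exponent_sequence_nonneg[OF \<beta> that(1)] exponent_sequence_nonneg[OF \<beta> that(2)]
      by (intro mult_left_mono) (auto simp: max_def)
    finally show ?thesis .
  qed
  moreover have "d \<ge> 1" by (simp add: d_def)
  ultimately show thesis using that by blast
qed

text \<open>
  Since \<open>\<alpha>\<close> is increasing, the terms \<open>exp ((1 - l) * \<alpha> i)\<close> of
  the convergent series from the Grothendieck--Pietsch criterion decrease, so \<open>n\<close> times the
  \<open>n\<close>-th term is at most the sum of the series.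
\<close>

lemma nuclear_index_growth:
  assumes \<alpha>: "exponent_sequence \<alpha>"
    and "nuclear_space (Lambda_inf \<alpha> :: (nat \<Rightarrow> 'a::{real_normed_field, banach}) set) (Lambda_norm \<alpha>)"
  obtains S :: real and q :: nat where "S \<ge> 0" "\<And>n. n \<ge> 1 \<Longrightarrow> real n \<le> S * exp (real q * \<alpha> n)"
proof -
  obtain l where l: "l > 1" and s: "(\<lambda>n. exp ((real 1 - real l) * \<alpha> n)) summable_on {1..}"
    using assms(2) unfolding nuclear_Lambda_inf_iff by blast
  define S where "S = (\<Sum>\<^sub>\<infinity>n\<in>{1..}. exp ((real 1 - real l) * \<alpha> n))"
  have "real n \<le> S * exp (real (l - 1) * \<alpha> n)" if n: "n \<ge> 1" for n
  proof -
    have "real n * exp ((real 1 - real l) * \<alpha> n) = (\<Sum>i\<in>{1..n}. exp ((real 1 - real l) * \<alpha> n))" by simp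
    also have "\<dots> \<le> (\<Sum>i\<in>{1..n}. exp ((real 1 - real l) * \<alpha> i))"
      using exponent_sequence_mono[OF \<alpha>] l by (intro sum_mono) (simp add: mult_left_mono_neg)
    also have "\<dots> \<le> S" unfolding S_def by (rule finite_sum_le_infsum[OF s]) auto
    finally have "real n * exp ((real 1 - real l) * \<alpha> n) * exp (real (l - 1) * \<alpha> n) \<le> S * exp (real (l - 1) * \<alpha> n)"
      by (rule mult_right_mono) simp
    moreover have "exp ((real 1 - real l) * \<alpha> n) * exp (real (l - 1) * \<alpha> n) = 1"
      using l by (simp add: of_nat_diff algebra_simps flip: exp_add)
    ultimately show ?thesis by (simp only: mult.assoc mult_1_right)
  qed
  moreover have "S \<ge> 0" unfolding S_def by (rule infsum_nonneg) simp
  ultimately show thesis using that by blast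
qed

definition exp_dominated :: "(nat \<Rightarrow> real) \<Rightarrow> (nat \<Rightarrow> real) \<Rightarrow> nat \<Rightarrow> bool"
  where "exp_dominated \<beta> \<alpha> m \<longleftrightarrow>
    (\<forall>k. \<exists>C\<ge>0. \<forall>n\<ge>1. exp (real k * \<beta> n) \<le> C * exp (real m * \<alpha> n))"

text \<open>
  The bound for \<open>k + 1\<close> covers all \<open>n > k\<close>; the finitely many remaining
  \<open>n\<close> are absorbed into the constant, since \<open>exp (m * \<alpha> n) \<ge> 1\<close>.
\<close>

lemma exp_dominatedI:
  assumes \<alpha>: "exponent_sequence \<alpha>" and \<beta>: "exponent_sequence \<beta>"
    and "\<forall>k\<ge>1. \<exists>C>0. \<forall>n\<ge>k. exp (real k * \<beta> n) \<le> C * exp (real m * \<alpha> n)"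
  shows "exp_dominated \<beta> \<alpha> m"
  unfolding exp_dominated_def
proof
  fix k :: nat
  obtain C where C: "C > 0" "\<And>n. n \<ge> k + 1 \<Longrightarrow> exp (real (k + 1) * \<beta> n) \<le> C * exp (real m * \<alpha> n)"
    using assms(3)[rule_format, of "k + 1"] by auto
  define B where "B = (\<Sum>i\<in>{1..k}. exp (real k * \<beta> i))"
  have B: "B \<ge> 0" unfolding B_def by (rule sum_nonneg) simp
  have "exp (real k * \<beta> n) \<le> (C + B) * exp (real m * \<alpha> n)" if n: "n \<ge> 1" for n
  proof (cases "n \<ge> k + 1")
    case True
    have "exp (real k * \<beta> n) \<le> exp (real (k + 1) * \<beta> n)"
      using exponent_sequence_nonneg[OF \<beta> n] by (simp add: mult_right_mono)
    also have "\<dots> \<le> C * exp (real m * \<alpha> n)" by (rule C(2)[OF True])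
    also have "\<dots> \<le> (C + B) * exp (real m * \<alpha> n)" using B by (intro mult_right_mono) auto
    finally show ?thesis .
  next
    case False
    have "exp (real k * \<beta> n) \<le> B"
      unfolding B_def using False n by (intro member_le_sum) auto
    also have "\<dots> \<le> (C + B) * 1" using C(1) by simp
    also have "\<dots> \<le> (C + B) * exp (real m * \<alpha> n)"
      using C(1) B exponent_sequence_nonneg[OF \<alpha> n] by (intro mult_left_mono) auto
    finally show ?thesis .
  qed
  moreover have "C + B \<ge> 0" using C(1) B by simp
  ultimately show "\<exists>C\<ge>0. \<forall>n\<ge>1. exp (real k * \<beta> n) \<le> C * exp (real m * \<alpha> n)" by blast
qed

text \<open>
  The \<open>n\<close>-th column is the symbol shifted down by \<open>n - 1\<close> places. By stability
  the weight at the shifted position is at most a product of a weight at the old position and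
  \<open>exp (k * d * \<beta> n)\<close>, so the column norm is at most a norm of the symbol times
  \<open>exp (k * d * \<beta> n)\<close>, and this factor is dominated by
  \<open>exp (m * \<alpha> n)\<close>.
\<close>

lemma bounded_columns_T_hat:
  fixes \<eta> :: "nat \<Rightarrow> 'a::real_normed_field"
  assumes \<beta>: "exponent_sequence \<beta>" and stable: "stable \<beta>"
    and dom: "exp_dominated \<beta> \<alpha> m" and \<eta>: "shift_seq \<eta> \<in> Lambda_inf \<beta>"
  shows "bounded_columns \<alpha> m \<beta> (T_hat_unit \<eta>)"
proof (rule bounded_columnsI)
  show "T_hat_unit \<eta> n 0 = 0" if "n \<ge> 1" for n using that by (simp add: T_hat_unit_def)
  fix k :: nat assume k: "k \<ge> 1"
  obtain d :: nat where d: "d \<ge> 1" "\<And>i n. i \<ge> 1 \<Longrightarrow> n \<ge> 1 \<Longrightarrow> \<beta> (n + i - 1) \<le> real d * (\<beta> n + \<beta> i)"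
    using stable_doubling[OF \<beta> stable] by blast
  define K where "K = k * d"
  have K: "K \<ge> 1" using k d(1) by (simp add: K_def)
  obtain C where C: "C \<ge> 0" "\<And>n. n \<ge> 1 \<Longrightarrow> exp (real K * \<beta> n) \<le> C * exp (real m * \<alpha> n)"
    using dom unfolding exp_dominated_def by meson
  let ?g = "\<lambda>i. norm (shift_seq \<eta> i) * exp (real K * \<beta> i)"
  have "(\<Sum>j\<in>F. norm (T_hat_unit \<eta> n j) * exp (real k * \<beta> j))
      \<le> (Lambda_norm \<beta> K (shift_seq \<eta>) * C) * exp (real m * \<alpha> n)"
    if n: "n \<ge> 1" and F: "finite F" "F \<subseteq> {1..}" for n F
  proof -
    let ?h = "\<lambda>j. j - n + 1"
    let ?F = "F \<inter> {n..}"
    have "(\<Sum>j\<in>F. norm (T_hat_unit \<eta> n j) * exp (real k * \<beta> j))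
        = (\<Sum>j\<in>?F. norm (T_hat_unit \<eta> n j) * exp (real k * \<beta> j))"
      using F(1) by (intro sum.mono_neutral_right) (auto simp: T_hat_unit_def)
    also have "\<dots> \<le> (\<Sum>j\<in>?F. ?g (?h j) * exp (real K * \<beta> n))"
    proof (rule sum_mono)
      fix j assume j: "j \<in> ?F"
      have "\<beta> j \<le> real d * (\<beta> n + \<beta> (?h j))" using d(2)[of "?h j" n] j n by simp
      then have "real k * \<beta> j \<le> real k * (real d * (\<beta> n + \<beta> (?h j)))" by (rule mult_left_mono) simp
      then have "exp (real k * \<beta> j) \<le> exp (real K * \<beta> (?h j)) * exp (real K * \<beta> n)"
        by (simp add: K_def algebra_simps flip: exp_add)
      then have "norm (shift_seq \<eta> (?h j)) * exp (real k * \<beta> j)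
          \<le> norm (shift_seq \<eta> (?h j)) * (exp (real K * \<beta> (?h j)) * exp (real K * \<beta> n))"
        by (rule mult_left_mono) simp
      moreover have "T_hat_unit \<eta> n j = shift_seq \<eta> (?h j)"
        using j by (simp add: T_hat_unit_def shift_seq_def)
      ultimately show "norm (T_hat_unit \<eta> n j) * exp (real k * \<beta> j) \<le> ?g (?h j) * exp (real K * \<beta> n)"
        by (simp add: mult.assoc)
    qed
    also have "\<dots> = (\<Sum>j\<in>?F. ?g (?h j)) * exp (real K * \<beta> n)" by (rule sum_distrib_right[symmetric])
    also have "(\<Sum>j\<in>?F. ?g (?h j)) = sum ?g (?h ` ?F)"
      by (rule sum.reindex_cong[symmetric, of ?h]) (auto simp: inj_on_def)
    also have "sum ?g (?h ` ?F) * exp (real K * \<beta> n) \<le> Lambda_norm \<beta> K (shift_seq \<eta>) * (C * exp (real m * \<alpha> n))"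
      using F(1) by (intro mult_mono Lambda_norm_coord_sum_le \<eta> K C(2) n Lambda_norm_nonneg) auto
    finally show ?thesis by (simp add: mult.assoc)
  qed
  moreover have "Lambda_norm \<beta> K (shift_seq \<eta>) * C \<ge> 0" using C(1) Lambda_norm_nonneg by (rule mult_nonneg_nonneg[rotated])
  ultimately show "\<exists>C\<ge>0. \<forall>n\<ge>1. \<forall>F. finite F \<and> F \<subseteq> {1..} \<longrightarrow>
      (\<Sum>j\<in>F. norm (T_hat_unit \<eta> n j) * exp (real k * \<beta> j)) \<le> C * exp (real m * \<alpha> n)" by blast
qed

text \<open>
  The \<open>n\<close>-th column has \<open>n\<close> entries, each at most
  \<open>D * exp (p * \<alpha> n)\<close>, with weights at most \<open>exp (k * \<beta> n)\<close>. The
  three factors \<open>n\<close>, \<open>exp (p * \<alpha> n)\<close> and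
  \<open>exp (k * \<beta> n)\<close> are bounded by \<open>exp (q * \<alpha> n)\<close>,
  \<open>exp (p * \<alpha> n)\<close> and \<open>exp (m * \<alpha> n)\<close> up to constants, and only
  the constants depend on \<open>k\<close>.
\<close>

lemma bounded_columns_T_check:
  fixes \<eta> :: "nat \<Rightarrow> 'a::real_normed_field"
  assumes \<alpha>: "exponent_sequence \<alpha>" and \<beta>: "exponent_sequence \<beta>"
    and S: "S \<ge> 0" "\<And>n. n \<ge> 1 \<Longrightarrow> real n \<le> S * exp (real q * \<alpha> n)"
    and dom: "exp_dominated \<beta> \<alpha> m"
    and D: "\<And>n. n \<ge> 1 \<Longrightarrow> norm (shift_seq \<eta> n) \<le> D * exp (real p * \<alpha> n)"
  shows "bounded_columns \<alpha> (q + p + m) \<beta> (T_check_unit \<eta>)"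
proof (rule bounded_columnsI)
  show "T_check_unit \<eta> n 0 = 0" for n by (simp add: T_check_unit_def)
  fix k :: nat
  obtain C where C: "C \<ge> 0" "\<And>n. n \<ge> 1 \<Longrightarrow> exp (real k * \<beta> n) \<le> C * exp (real m * \<alpha> n)"
    using dom unfolding exp_dominated_def by meson
  have D0: "D \<ge> 0" using D[of 1] norm_ge_zero[of "shift_seq \<eta> 1"]
    by (metis dual_order.trans exp_gt_zero le_refl zero_le_mult_iff not_le)
  have "(\<Sum>j\<in>F. norm (T_check_unit \<eta> n j) * exp (real k * \<beta> j))
      \<le> (S * D * C) * exp (real (q + p + m) * \<alpha> n)"
    if n: "n \<ge> 1" and F: "finite F" "F \<subseteq> {1..}" for n F
  proof -
    let ?E = "D * exp (real p * \<alpha> n) * (C * exp (real m * \<alpha> n))"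
    have "(\<Sum>j\<in>F. norm (T_check_unit \<eta> n j) * exp (real k * \<beta> j))
        = (\<Sum>j\<in>F \<inter> {1..n}. norm (T_check_unit \<eta> n j) * exp (real k * \<beta> j))"
      using F(1) by (intro sum.mono_neutral_right) (auto simp: T_check_unit_def)
    also have "\<dots> \<le> (\<Sum>j\<in>F \<inter> {1..n}. ?E)"
    proof (rule sum_mono)
      fix j assume j: "j \<in> F \<inter> {1..n}"
      have "norm (T_check_unit \<eta> n j) = norm (shift_seq \<eta> (n - j + 1))"
        using j by (simp add: T_check_unit_def shift_seq_def)
      also have "\<dots> \<le> D * exp (real p * \<alpha> (n - j + 1))" by (rule D) simp
      also have "\<dots> \<le> D * exp (real p * \<alpha> n)"
      proof -
        have "n - j + 1 \<le> n" using j by auto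
        then have "\<alpha> (n - j + 1) \<le> \<alpha> n" by (intro exponent_sequence_mono[OF \<alpha>]) auto
        then show ?thesis using D0 by (simp add: mult_left_mono)
      qed
      finally have 1: "norm (T_check_unit \<eta> n j) \<le> D * exp (real p * \<alpha> n)" .
      have "exp (real k * \<beta> j) \<le> exp (real k * \<beta> n)"
        using j exponent_sequence_mono[OF \<beta>, of j n] by (simp add: mult_left_mono)
      also have "\<dots> \<le> C * exp (real m * \<alpha> n)" by (rule C(2)[OF n])
      finally show "norm (T_check_unit \<eta> n j) * exp (real k * \<beta> j) \<le> ?E"
        using 1 D0 by (intro mult_mono) auto
    qed
    also have "\<dots> = real (card (F \<inter> {1..n})) * ?E" by simp
    also have "\<dots> \<le> (S * exp (real q * \<alpha> n)) * ?E"
    proof (rule mult_right_mono)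
      have "card (F \<inter> {1..n}) \<le> n" using card_mono[of "{1..n}" "F \<inter> {1..n}"] by simp
      then show "real (card (F \<inter> {1..n})) \<le> S * exp (real q * \<alpha> n)" using S(2)[OF n] by linarith
      show "0 \<le> ?E" using D0 C(1) by simp
    qed
    also have "\<dots> = (S * D * C) * exp (real (q + p + m) * \<alpha> n)"
      by (simp add: distrib_right exp_add)
    finally show ?thesis .
  qed
  moreover have "S * D * C \<ge> 0" using S(1) D0 C(1) by simp
  ultimately show "\<exists>C\<ge>0. \<forall>n\<ge>1. \<forall>F. finite F \<and> F \<subseteq> {1..} \<longrightarrow>
      (\<Sum>j\<in>F. norm (T_check_unit \<eta> n j) * exp (real k * \<beta> j)) \<le> C * exp (real (q + p + m) * \<alpha> n)" by blast
qed

lemma Lambda_dual_bound: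
  assumes "y \<in> Lambda_dual \<alpha>"
  obtains D :: real and p :: nat where "\<And>n. n \<ge> 1 \<Longrightarrow> norm (y n) \<le> D * exp (real p * \<alpha> n)"
proof -
  obtain p D where D: "\<And>n. n \<ge> 1 \<Longrightarrow> norm (y n) * exp (- real p * \<alpha> n) \<le> D"
    using assms unfolding Lambda_dual_def bdd_above_def by auto
  have "norm (y n) \<le> D * exp (real p * \<alpha> n)" if "n \<ge> 1" for n
    using D[OF that] by (simp add: exp_minus field_simps)
  then show thesis by (rule that)
qed

section \<open>Compactness of the Toeplitz operator\<close>

theorem theorem5p4:
  fixes \<alpha> \<beta> :: "nat \<Rightarrow> real"
    and \<theta> :: "int \<Rightarrow> 'a::{real_normed_field, banach}"
    and t' t'' :: 'a
  assumes "exponent_sequence \<alpha>" and "exponent_sequence \<beta>"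
    and "stable \<beta>"
    and "nuclear_space (Lambda_inf \<alpha> :: (nat \<Rightarrow> 'a) set) (Lambda_norm \<alpha>)"
    and "\<theta> 0 = t' + t''" and "t' \<noteq> 0" and "t'' \<noteq> 0"
    and "infinite {j. theta_hat \<theta> t' j \<noteq> 0}"
    and "infinite {j. theta_check \<theta> t'' j \<noteq> 0}"
    and "shift_seq (theta_hat \<theta> t') \<in> Lambda_inf \<beta>"
    and "shift_seq (theta_check \<theta> t'') \<in> Lambda_dual \<alpha>"
    and "\<exists>m\<ge>1. \<forall>k\<ge>1. \<exists>C>0. \<forall>n\<ge>k. exp (real k * \<beta> n) \<le> C * exp (real m * \<alpha> n)"
  shows "toeplitz_well_defined (Lambda_inf \<alpha>) (Lambda_topology \<beta>) \<theta> t' t'' \<and>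
    compact_operator (Lambda_inf \<alpha>) (Lambda_norm \<alpha>) (Lambda_inf \<beta>) (Lambda_norm \<beta>)
      (toeplitz (Lambda_topology \<beta>) \<theta> t' t'')"
proof -
  note \<alpha> = assms(1) and \<beta> = assms(2)
  obtain m where m: "m \<ge> 1" "\<forall>k\<ge>1. \<exists>C>0. \<forall>n\<ge>k. exp (real k * \<beta> n) \<le> C * exp (real m * \<alpha> n)"
    using assms(12) by (elim exE conjE)
  note dom = exp_dominatedI[OF \<alpha> \<beta> m(2)]
  obtain S q where S: "S \<ge> 0" "\<And>n. n \<ge> 1 \<Longrightarrow> real n \<le> S * exp (real q * \<alpha> n)"
    by (rule nuclear_index_growth[OF \<alpha> assms(4)]) (rule that)
  obtain D p where D: "\<And>n. n \<ge> 1 \<Longrightarrow> norm (shift_seq (theta_check \<theta> t'') n) \<le> D * exp (real p * \<alpha> n)"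
    by (rule Lambda_dual_bound[OF assms(11)]) (rule that)
  define M where "M = q + p + m"
  define a where "a = T_hat_unit (theta_hat \<theta> t')"
  define b where "b = T_check_unit (theta_check \<theta> t'')"
  have M: "M \<ge> 1" using m(1) by (simp add: M_def)
  have a: "bounded_columns \<alpha> M \<beta> a"
    unfolding a_def
    by (rule bounded_columns_mono[OF \<alpha> bounded_columns_T_hat[OF \<beta> assms(3) dom assms(10)]]) (simp add: M_def)
  have b: "bounded_columns \<alpha> M \<beta> b"
    unfolding b_def M_def by (rule bounded_columns_T_check[OF \<alpha> \<beta> S dom D])
  let ?T = "toeplitz (Lambda_topology \<beta>) \<theta> t' t''"
  have T: "?T x = (\<lambda>j. column_sum a x j + column_sum b x j)" if "x \<in> Lambda_inf \<alpha>" for x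
    unfolding toeplitz_def a_def[symmetric] b_def[symmetric]
    by (simp only: series_operator_eq_column_sum[OF \<beta> M a that] series_operator_eq_column_sum[OF \<beta> M b that])
  have "toeplitz_well_defined (Lambda_inf \<alpha>) (Lambda_topology \<beta>) \<theta> t' t''"
    unfolding toeplitz_well_defined_def a_def[symmetric] b_def[symmetric]
    by (intro conjI series_well_defined_bounded_columns[OF \<beta> M] a b)
  moreover have "compact_operator (Lambda_inf \<alpha>) (Lambda_norm \<alpha>) (Lambda_inf \<beta>) (Lambda_norm \<beta>) ?T"
  proof (rule compact_operator_seminorm_bounded[OF \<beta> M])
    fix x :: "nat \<Rightarrow> 'a" assume x: "x \<in> Lambda_inf \<alpha>"
    show "?T x \<in> Lambda_inf \<beta>"
      unfolding T[OF x] by (intro Lambda_inf_add column_sum_mem[OF \<beta> M a x] column_sum_mem[OF \<beta> M b x])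
    show "?T (\<lambda>n. r * x n) = (\<lambda>n. r * ?T x n)" for r :: 'a
      unfolding T[OF x] T[OF Lambda_inf_scale[OF x]] column_sum_scale[OF \<beta> M a] column_sum_scale[OF \<beta> M b]
      by (simp add: distrib_left)
    fix y :: "nat \<Rightarrow> 'a" assume y: "y \<in> Lambda_inf \<alpha>"
    show "?T (\<lambda>n. x n + y n) = (\<lambda>n. ?T x n + ?T y n)"
      unfolding T[OF x] T[OF y] T[OF Lambda_inf_add[OF x y]]
        column_sum_add[OF \<beta> M a x y] column_sum_add[OF \<beta> M b x y]
      by (simp add: add_ac)
  next
    fix k :: nat assume k: "k \<ge> 1"
    obtain A where A: "A \<ge> 0" "\<And>x. x \<in> Lambda_inf \<alpha> \<Longrightarrow> Lambda_norm \<beta> k (column_sum a x) \<le> A * Lambda_norm \<alpha> M x"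
      by (rule column_sum_bound[OF \<beta> M a k]) (rule that)
    obtain B where B: "B \<ge> 0" "\<And>x. x \<in> Lambda_inf \<alpha> \<Longrightarrow> Lambda_norm \<beta> k (column_sum b x) \<le> B * Lambda_norm \<alpha> M x"
      by (rule column_sum_bound[OF \<beta> M b k]) (rule that)
    have "Lambda_norm \<beta> k (?T x) \<le> (A + B) * Lambda_norm \<alpha> M x" if x: "x \<in> Lambda_inf \<alpha>" for x
      using Lambda_norm_triangle[OF column_sum_mem[OF \<beta> M a x] column_sum_mem[OF \<beta> M b x] k] A(2)[OF x] B(2)[OF x]
      unfolding T[OF x] distrib_right by linarith
    moreover have "A + B \<ge> 0" using A(1) B(1) by simp
    ultimately show "\<exists>C\<ge>0. \<forall>x\<in>Lambda_inf \<alpha>. Lambda_norm \<beta> k (?T x) \<le> C * Lambda_norm \<alpha> M x" by blast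
  qed
  ultimately show ?thesis by blast
qed

end
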